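(* For every integer $k$ with $1 \le k \le 29$ one has $i(\infty,k) > i(\infty,k+1)$; that is, $i(\infty,1) > i(\infty,2) > \cdots > i(\infty,30)$.
   Context: For integers $n \ge k \ge 1$, the symmetric group $\mathrm{Sym}_n$ acts on the set of $k$-element subsets of $\{1,\ldots,n\}$. Let $i(n,k)$ be the proportion of permutations in $\mathrm{Sym}_n$ that fix (setwise) at least one $k$-subset of $\{1,\ldots,n\}$. Define $i(\infty,k) = \lim_{n\to\infty} i(n,k)$; this limit exists for every $k \ge 1$. *)

theory Defs
  imports Complex_Main "HOL-Combinatorics.Permutations"
begin

definition fixing_perms :: "nat \<Rightarrow> nat \<Rightarrow> (nat \<Rightarrow> nat) set" where
  "fixing_perms n k =
     {p. p permutes {1..n} \<and> (\<exists>S. S \<subseteq> {1..n} \<and> card S = k \<and> p ` S = S)}"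

definition i_prop :: "nat \<Rightarrow> nat \<Rightarrow> real" where
  "i_prop n k = real (card (fixing_perms n k)) / real (card {p. p permutes {1..n}})"

(* For n < k there is no k-subset and i_prop n k = 0; this does not affect the limit.
   lim is meaningful because the sequence converges for every k >= 1. *)
definition i_infty :: "nat \<Rightarrow> real" where
  "i_infty k = lim (\<lambda>n. i_prop n k)"

end

theory Submission
  imports Defs "HOL-Analysis.Uniform_Limit"
begin

text \<open>
  Write \<open>q n\<close> for the proportion of permutations of \<open>{1..n}\<close> that fix no \<open>k\<close>-set, so that
  \<open>i_prop n k = 1 - q n\<close>. The limit of \<open>q n\<close> is the probability that independent Poisson
  variables \<open>X\<^sub>1, X\<^sub>2, \<dots>\<close> with means \<open>1, 1/2, 1/3, \<dots>\<close> (the limiting numbers of cycles of each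
  length) do not allow \<open>k\<close> to be written as a sum of lengths of distinct cycles. The proof computes
  this probability for every \<open>k \<le> 30\<close> with an error below the gap between neighbouring values,
  which for \<open>k\<close> near 30 is about \<open>0.002\<close>.

  The limit is obtained without cycle types. For a set \<open>A\<close> of partial sums already available, let
  \<open>q n A\<close> be the probability that no element of \<open>A\<close> plus the size of an invariant set equals \<open>k\<close>.
  Removing the cycle through one point gives \<open>n q n A = (\<Sum>j=1..n. q (n - j) (A \<union> (A + j)))\<close>, because the
  length of that cycle is uniform on \<open>{1..n}\<close> and the rest is again a uniform permutation
  (\<open>card_avoiding_insert_unit_weights\<close>). The same recursion restricted to \<open>j > m\<close> defines
  \<open>avoid_prob k m\<close>, in which all cycles are longer than \<open>m\<close>. Allowing cycles of length \<open>m\<close> again, or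
  forbidding them, amounts to a convolution with the coefficients of \<open>exp (x^m / m)\<close> or of
  \<open>exp (- x^m / m)\<close> (\<open>insert_cycles_rec\<close>). Tannery's theorem carries these finite convolutions to the
  limit, and yields \<open>i_infty k = 1 - avoid_lim k k {0}\<close>, where \<open>avoid_lim\<close> treats the lengths
  \<open>1, \<dots>, k\<close> one after the other and \<open>c\<close> cycles of length \<open>m\<close> contribute the weight
  \<open>1 / (m^c c!)\<close>. After all lengths up to \<open>k\<close> only the factor \<open>exp (- harmonic k)\<close> remains.

  Once the lengths up to \<open>m\<close> have been treated, a partial sum \<open>s\<close> with \<open>k - m \<le> s < k\<close> is of no
  further use, so a state is the characteristic list of the partial sums below \<open>k - m\<close>
  (\<open>avoid_lim_cong\<close>). This makes the number of distinct states small: at most about two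
  thousand per length for \<open>k = 30\<close>. A finite measure on states is stored as a binary trie with
  integer weights at the tips, all divisions being rounded down for a lower bound and up for an
  upper bound. Treating one length is a sequence of shifts, divisions and merges of tries
  (\<open>level_rounds\<close>), and at the end the whole measure sits on a single state, whose weight bounds
  \<open>avoid_lim k k {0} * exp (harmonic k)\<close> up to the initial scale (\<open>weight_rounds\<close>). Comparing the
  upper weight for \<open>k\<close> with the lower weight for \<open>k + 1\<close>, corrected by
  \<open>exp (1 / (k + 1)) \<le> 1 + 1 / (k + 1) + 1 / (k + 1)^2\<close>, proves the inequality (\<open>certified_imp\<close>).
\<close>

section \<open>Permutations weighted by invariant sets\<close>

definition shift_union :: "nat \<Rightarrow> nat set \<Rightarrow> nat set" where
  "shift_union j A = A \<union> (\<lambda>x. x + j) ` A"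

definition avoids :: "nat \<Rightarrow> 'a set \<Rightarrow> ('a \<Rightarrow> nat) \<Rightarrow> nat set \<Rightarrow> ('a \<Rightarrow> 'a) \<Rightarrow> bool" where
  "avoids k S w A p \<longleftrightarrow> (\<forall>T. T \<subseteq> S \<longrightarrow> p ` T = T \<longrightarrow> (\<forall>x\<in>A. x + sum w T \<noteq> k))"

definition avoiding :: "nat \<Rightarrow> 'a set \<Rightarrow> ('a \<Rightarrow> nat) \<Rightarrow> nat set \<Rightarrow> ('a \<Rightarrow> 'a) set" where
  "avoiding k S w A = {p. p permutes S \<and> avoids k S w A p}"

lemma shift_union_comm: "shift_union i (shift_union j A) = shift_union j (shift_union i A)"
  by (auto simp: shift_union_def image_iff algebra_simps)

text \<open>
  The element \<open>a\<close> is a fixed point of \<open>q\<close>, so it may be added to any invariant subset of \<open>S\<close>: this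
  offers the additional partial sums \<open>x + w a\<close>.
\<close>

lemma avoids_insert_fixed:
  assumes "finite S" "a \<notin> S" "q permutes S"
  shows "avoids k (insert a S) w A q \<longleftrightarrow> avoids k S w (shift_union (w a) A) q"
proof -
  have qa: "q a = a" using assms by (simp add: permutes_not_in)
  have ins: "q ` insert a T = insert a T \<longleftrightarrow> q ` T = T" if "T \<subseteq> S" for T
  proof -
    have "q ` T \<subseteq> S" using that assms(3) permutes_image by blast
    then have "a \<notin> q ` T" "a \<notin> T" using that assms(2) by auto
    then show ?thesis using qa by auto
  qed
  have sums: "sum w (insert a T) = w a + sum w T" if "T \<subseteq> S" for T
    using that assms finite_subset[OF that] by (subst sum.insert) auto
  have "avoids k (insert a S) w A q \<longleftrightarrow>
     (\<forall>T. T \<subseteq> S \<longrightarrow> (q ` T = T \<longrightarrow> (\<forall>x\<in>A. x + sum w T \<noteq> k)) \<and>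
        (q ` insert a T = insert a T \<longrightarrow> (\<forall>x\<in>A. x + sum w (insert a T) \<noteq> k)))" (is "_ \<longleftrightarrow> ?R")
  proof
    assume "avoids k (insert a S) w A q"
    then show ?R unfolding avoids_def by (metis insert_mono subset_insertI2)
  next
    assume R: ?R
    show "avoids k (insert a S) w A q" unfolding avoids_def
    proof (intro allI impI)
      fix T assume T: "T \<subseteq> insert a S" "q ` T = T"
      show "\<forall>x\<in>A. x + sum w T \<noteq> k"
      proof (cases "a \<in> T")
        case True
        then have "insert a (T - {a}) = T" "T - {a} \<subseteq> S" using T by auto
        then show ?thesis using R T(2) by metis
      next
        case False
        then have "T \<subseteq> S" using T by auto
        then show ?thesis using R T(2) by blast
      qed
    qed
  qed
  also have "\<dots> \<longleftrightarrow> (\<forall>T. T \<subseteq> S \<longrightarrow> q ` T = T \<longrightarrow> (\<forall>x\<in>A. x + sum w T \<noteq> k \<and> x + w a + sum w T \<noteq> k))"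
  proof (intro all_cong1 imp_cong refl)
    fix T assume T: "T \<subseteq> S"
    show "((q ` T = T \<longrightarrow> (\<forall>x\<in>A. x + sum w T \<noteq> k)) \<and>
        (q ` insert a T = insert a T \<longrightarrow> (\<forall>x\<in>A. x + sum w (insert a T) \<noteq> k))) \<longleftrightarrow>
      (q ` T = T \<longrightarrow> (\<forall>x\<in>A. x + sum w T \<noteq> k \<and> x + w a + sum w T \<noteq> k))"
      unfolding ins[OF T] sums[OF T] add.assoc by blast
  qed
  also have "\<dots> \<longleftrightarrow> avoids k S w (shift_union (w a) A) q"
    unfolding avoids_def shift_union_def by blast
  finally show ?thesis .
qed

text \<open>
  Composing with the transposition puts \<open>a\<close> into the cycle of \<open>q\<close> right before \<open>b\<close>. An invariant
  set then contains \<open>a\<close> if and only if it contains \<open>b\<close>, so the pair behaves like the single point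
  \<open>b\<close> with the sum of both weights.
\<close>

lemma avoids_insert_cycle:
  assumes "finite S" "a \<notin> S" "q permutes S" "b \<in> S"
  shows "avoids k (insert a S) w A (Transposition.transpose a b \<circ> q) \<longleftrightarrow> avoids k S (w(b := w b + w a)) A q"
proof -
  define p where "p = Transposition.transpose a b \<circ> q"
  have ab: "a \<noteq> b" using assms by auto
  have qa: "q a = a" using assms by (simp add: permutes_not_in)
  have pa: "p a = b" by (simp add: p_def qa)
  have injp: "inj p" unfolding p_def by (rule inj_compose[OF inj_transpose permutes_inj[OF assms(3)]])
  have q_eq: "q = Transposition.transpose a b \<circ> p" by (simp add: p_def fun_eq_iff)
  have swap: "Transposition.transpose a b ` T = T" if "a \<in> T \<longleftrightarrow> b \<in> T" for T
    using that by (simp add: transpose_image_eq)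
  define e where "e T = (if b \<in> T then insert a T else T)" for T
  have eT: "p ` e T = e T \<longleftrightarrow> q ` T = T" if T: "T \<subseteq> S" for T
  proof -
    have aT: "a \<notin> T" using T assms by auto
    have aqT: "a \<notin> q ` T" using T assms permutes_image[OF assms(3)] by blast
    have "p ` e T = e T \<longleftrightarrow> Transposition.transpose a b ` (p ` e T) = Transposition.transpose a b ` e T"
      by (rule inj_image_eq_iff[OF inj_transpose, symmetric])
    also have "Transposition.transpose a b ` e T = e T" by (rule swap) (auto simp: e_def aT)
    also have "Transposition.transpose a b ` (p ` e T) = q ` e T" by (simp add: q_eq image_image)
    also have "q ` e T = e T \<longleftrightarrow> q ` T = T"
      using aT aqT qa by (auto simp: e_def)
    finally show ?thesis .
  qed
  have sums: "sum w (e T) = sum (w(b := w b + w a)) T" if T: "T \<subseteq> S" for T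
  proof -
    have f: "finite T" using T assms finite_subset by blast
    have aT: "a \<notin> T" using T assms by auto
    show ?thesis
    proof (cases "b \<in> T")
      case True
      then have "sum (w(b := w b + w a)) T = w b + w a + sum w (T - {b})"
        using f by (subst sum.remove[of _ b]) (auto intro!: sum.cong)
      also have "\<dots> = w a + sum w T" using f True by (subst (2) sum.remove[of _ b]) auto
      finally show ?thesis using True f aT by (simp add: e_def)
    next
      case False
      then show ?thesis by (auto simp: e_def intro!: sum.cong)
    qed
  qed
  have cover: "\<exists>T'. T' \<subseteq> S \<and> T = e T'" if T: "T \<subseteq> insert a S" "p ` T = T" for T
  proof -
    have fT: "finite T" using T(1) assms(1) by (meson finite.insertI finite_subset)
    have "a \<in> T \<longleftrightarrow> b \<in> T"
      using inj_image_mem_iff[OF injp, of a T] by (simp add: T(2) pa)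
    then have "T = e (T - {a})" using ab by (auto simp: e_def)
    moreover have "T - {a} \<subseteq> S" using T by auto
    ultimately show ?thesis by blast
  qed
  have esub: "e T \<subseteq> insert a S" if "T \<subseteq> S" for T using that by (auto simp: e_def)
  have "avoids k (insert a S) w A p \<longleftrightarrow>
     (\<forall>T. T \<subseteq> S \<longrightarrow> p ` e T = e T \<longrightarrow> (\<forall>x\<in>A. x + sum w (e T) \<noteq> k))"
    unfolding avoids_def using cover esub by metis
  also have "\<dots> \<longleftrightarrow> avoids k S (w(b := w b + w a)) A q"
    unfolding avoids_def using eT sums by metis
  finally show ?thesis unfolding p_def .
qed

text \<open>
  Arbitrary weights are what makes this recursion close up: merging \<open>a\<close> into \<open>b\<close> changes the
  weight of one point only.
\<close>

lemma card_avoiding_insert: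
  assumes S: "finite S" "a \<notin> S"
  shows "card (avoiding k (insert a S) w A) =
     card (avoiding k S w (shift_union (w a) A)) + (\<Sum>b\<in>S. card (avoiding k S (w(b := w b + w a)) A))"
proof -
  define B where "B b = (if b = a then avoiding k S w (shift_union (w a) A) else avoiding k S (w(b := w b + w a)) A)" for b
  define g :: "'a \<times> ('a \<Rightarrow> 'a) \<Rightarrow> 'a \<Rightarrow> 'a" where "g = (\<lambda>(b, q). Transposition.transpose a b \<circ> q)"
  have finB: "finite (B b)" for b
    using finite_permutations[OF S(1)] by (auto simp: B_def avoiding_def)
  have mem: "q \<in> B b \<longleftrightarrow> q permutes S \<and> avoids k (insert a S) w A (Transposition.transpose a b \<circ> q)" if "b \<in> insert a S" for b q
  proof (cases "b = a")
    case True
    have "Transposition.transpose a a \<circ> q = q" by (simp add: Transposition.transpose_def fun_eq_iff)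
    then show ?thesis using True avoids_insert_fixed[OF S] by (auto simp: B_def avoiding_def)
  next
    case False
    then have "b \<in> S" using that by auto
    then show ?thesis using False avoids_insert_cycle[OF S] by (auto simp: B_def avoiding_def)
  qed
  have "avoiding k (insert a S) w A = g ` (SIGMA b:insert a S. B b)"
  proof (rule set_eqI)
    fix p
    have "p \<in> avoiding k (insert a S) w A \<longleftrightarrow>
      p \<in> (\<lambda>(b, p). Transposition.transpose a b \<circ> p) ` {(b, p). b \<in> insert a S \<and> p \<in> {p. p permutes S}} \<and> avoids k (insert a S) w A p"
      unfolding avoiding_def permutes_insert[symmetric] by simp
    also have "\<dots> \<longleftrightarrow> p \<in> g ` (SIGMA b:insert a S. B b)"
      using mem by (force simp: g_def image_iff)
    finally show "p \<in> avoiding k (insert a S) w A \<longleftrightarrow> p \<in> g ` (SIGMA b:insert a S. B b)" .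
  qed
  moreover have "inj_on g (SIGMA b:insert a S. B b)"
  proof (rule inj_onI, clarify)
    fix b q c r
    assume bq: "b \<in> insert a S" "q \<in> B b" and cr: "c \<in> insert a S" "r \<in> B c" and eq: "g (b, q) = g (c, r)"
    have "q a = a" "r a = a" using bq cr mem S(2) by (auto simp: permutes_not_in)
    then have "b = c" using fun_cong[OF eq, of a] by (simp add: g_def)
    moreover have "q = r"
    proof
      fix x
      show "q x = r x" using fun_cong[OF eq, of x] \<open>b = c\<close>
        by (simp add: g_def) (metis Transposition.transpose_involutory)
    qed
    ultimately show "b = c \<and> q = r" by simp
  qed
  ultimately have "card (avoiding k (insert a S) w A) = card (SIGMA b:insert a S. B b)"
    by (simp add: card_image)
  also have "\<dots> = (\<Sum>b\<in>insert a S. card (B b))" using S(1) finB by (simp add: card_SigmaI)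
  also have "\<dots> = card (B a) + (\<Sum>b\<in>S. card (B b))" using S by simp
  also have "(\<Sum>b\<in>S. card (B b)) = (\<Sum>b\<in>S. card (avoiding k S (w(b := w b + w a)) A))"
    using S(2) by (intro sum.cong) (auto simp: B_def)
  finally show ?thesis by (simp add: B_def)
qed

text \<open>
  For \<open>m = 0\<close> this is the probability that a uniform permutation of \<open>n\<close> points has no invariant
  set whose size completes an element of \<open>A\<close> to \<open>k\<close>. In general it is the probability of the same
  event together with the absence of cycles of length at most \<open>m\<close>.
\<close>

function avoid_prob :: "nat \<Rightarrow> nat \<Rightarrow> nat \<Rightarrow> nat set \<Rightarrow> real" where
  "avoid_prob k m n A = (if n = 0 then of_bool (k \<notin> A)
     else (\<Sum>j\<in>{m<..n}. avoid_prob k m (n - j) (shift_union j A)) / n)"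
  by auto
termination by (relation "measure (\<lambda>(k, m, n, A). n)") auto

declare avoid_prob.simps [simp del]

lemma avoid_prob_0: "avoid_prob k m 0 A = of_bool (k \<notin> A)"
  by (simp add: avoid_prob.simps)

lemma avoid_prob_rec:
  "n * avoid_prob k m n A = (\<Sum>j\<in>{m<..n}. avoid_prob k m (n - j) (shift_union j A))"
  by (cases "n = 0") (simp_all add: avoid_prob.simps[of k m n])

lemma avoid_prob_Suc:
  "Suc n * avoid_prob k 0 (Suc n) A = (\<Sum>j\<le>n. avoid_prob k 0 (n - j) (shift_union (Suc j) A))"
proof -
  have "{0<..Suc n} = Suc ` {..n}"
    by (simp add: atMost_atLeast0 image_Suc_atLeastAtMost atLeastSucAtMost_greaterThanAtMost)
  then have "(\<Sum>j\<in>{0<..Suc n}. avoid_prob k 0 (Suc n - j) (shift_union j A)) =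
    (\<Sum>j\<le>n. avoid_prob k 0 (n - j) (shift_union (Suc j) A))"
    by (simp add: sum.reindex)
  then show ?thesis using avoid_prob_rec[of "Suc n" k 0 A] by (simp del: of_nat_Suc)
qed

text \<open>
  The point \<open>a\<close> stands for a stretch of \<open>w a\<close> consecutive elements of one cycle. Each step of the
  recursion either closes this cycle or absorbs one more point of \<open>S\<close> into it; the summation index
  \<open>j\<close> is the number of points absorbed before the cycle is closed.
\<close>

lemma card_avoiding_insert_unit_weights:
  assumes "finite S" "a \<notin> S" "\<And>x. x \<in> S \<Longrightarrow> w x = 1"
  shows "card (avoiding k (insert a S) w A) =
    fact (card S) * (\<Sum>j\<le>card S. avoid_prob k 0 (card S - j) (shift_union (w a + j) A))"
  using assms
proof (induction "card S" arbitrary: S a w A rule: less_induct)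
  case less
  note S = less.prems
  have unit: "card (avoiding k S w A) = fact (card S) * avoid_prob k 0 (card S) A" for A
  proof (cases "S = {}")
    case True
    have "avoiding k S w A = (if k \<in> A then {} else {id})"
      by (auto simp: avoiding_def avoids_def True)
    then show ?thesis using True by (auto simp: avoid_prob_0)
  next
    case False
    then obtain c where c: "c \<in> S" by auto
    define R where "R = S - {c}"
    have R: "S = insert c R" "c \<notin> R" "finite R" "card S = Suc (card R)"
      using c S(1) by (auto simp: R_def card_Suc_Diff1[symmetric] simp del: card_Diff_insert)
    have "card (avoiding k S w A) =
      fact (card R) * (\<Sum>j\<le>card R. avoid_prob k 0 (card R - j) (shift_union (w c + j) A))"
      unfolding R(1) by (rule less.hyps) (use R S in auto)
    also have "w c = 1" using S c by auto
    also have "(\<Sum>j\<le>card R. avoid_prob k 0 (card R - j) (shift_union (1 + j) A)) =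
       Suc (card R) * avoid_prob k 0 (Suc (card R)) A" using avoid_prob_Suc by simp
    finally show ?thesis using R by (simp add: algebra_simps)
  qed
  have step: "real (card (avoiding k S (w(b := w b + w a)) A)) =
    fact (card S - 1) * (\<Sum>j\<in>{1..card S}. avoid_prob k 0 (card S - j) (shift_union (w a + j) A))"
    if b: "b \<in> S" for b
  proof -
    define R where "R = S - {b}"
    have R: "S = insert b R" "b \<notin> R" "finite R" "card S = Suc (card R)"
      using b S(1) by (auto simp: R_def card_Suc_Diff1[symmetric] simp del: card_Diff_insert)
    define w' where "w' = w(b := w b + w a)"
    have "real (card (avoiding k (insert b R) w' A)) =
      fact (card R) * (\<Sum>j\<le>card R. avoid_prob k 0 (card R - j) (shift_union (w' b + j) A))"
      by (rule less.hyps) (use R S in \<open>auto simp: w'_def\<close>)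
    also have "w' b = 1 + w a" using S b by (simp add: w'_def)
    also have "(\<Sum>j\<le>card R. avoid_prob k 0 (card R - j) (shift_union (1 + w a + j) A)) =
      (\<Sum>j\<in>Suc ` {..card R}. avoid_prob k 0 (card S - j) (shift_union (w a + j) A))"
      by (subst sum.reindex) (auto simp: R(4))
    also have "Suc ` {..card R} = {1..card S}"
      using R by (simp add: atMost_atLeast0 image_Suc_atLeastAtMost)
    finally show ?thesis unfolding w'_def R(1)[symmetric] by (simp only: R(4) diff_Suc_1)
  qed
  have "real (card (avoiding k (insert a S) w A)) =
    real (card (avoiding k S w (shift_union (w a) A))) + (\<Sum>b\<in>S. real (card (avoiding k S (w(b := w b + w a)) A)))"
    using card_avoiding_insert[OF S(1,2)] by simp
  also have "(\<Sum>b\<in>S. real (card (avoiding k S (w(b := w b + w a)) A))) =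
     card S * (fact (card S - 1) * (\<Sum>j\<in>{1..card S}. avoid_prob k 0 (card S - j) (shift_union (w a + j) A)))"
    by (simp add: step)
  also have "\<dots> = fact (card S) * (\<Sum>j\<in>{1..card S}. avoid_prob k 0 (card S - j) (shift_union (w a + j) A))"
    by (cases "card S") auto
  also have "real (card (avoiding k S w (shift_union (w a) A))) + \<dots> =
    fact (card S) * (\<Sum>j\<le>card S. avoid_prob k 0 (card S - j) (shift_union (w a + j) A))"
  proof -
    have "{..card S} = insert 0 {1..card S}" by auto
    then show ?thesis by (simp add: unit algebra_simps)
  qed
  finally show ?case .
qed

lemma i_prop_eq:
  assumes "n > 0"
  shows "i_prop n k = 1 - avoid_prob k 0 n {0}"
proof -
  define w :: "nat \<Rightarrow> nat" where "w = (\<lambda>_. 1)"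
  obtain m where n: "n = Suc m" using assms gr0_implies_Suc by blast
  have ins: "{1..n} = insert n {1..m}" using n by auto
  have "real (card (avoiding k {1..n} w {0})) =
    fact m * (\<Sum>j\<le>m. avoid_prob k 0 (m - j) (shift_union (Suc j) {0}))"
    unfolding ins using card_avoiding_insert_unit_weights[of "{1..m}" n w k "{0}"] n by (simp add: w_def)
  also have "\<dots> = fact n * avoid_prob k 0 n {0}"
    using avoid_prob_Suc[of m k "{0}"] n by simp
  finally have 1: "real (card (avoiding k {1..n} w {0})) = fact n * avoid_prob k 0 n {0}" .
  have fin: "finite {p. p permutes {1..n}}" by (simp add: finite_permutations)
  have cp: "card {p. p permutes {1..n}} = fact n" by (simp add: card_permutations)
  have "p \<in> fixing_perms n k \<longleftrightarrow> p permutes {1..n} \<and> \<not> avoids k {1..n} w {0} p" for p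
    by (simp add: fixing_perms_def avoids_def w_def) metis
  then have "fixing_perms n k = {p. p permutes {1..n}} - avoiding k {1..n} w {0}"
    by (auto simp: avoiding_def)
  moreover have sub: "avoiding k {1..n} w {0} \<subseteq> {p. p permutes {1..n}}" by (auto simp: avoiding_def)
  ultimately have "card (fixing_perms n k) = fact n - card (avoiding k {1..n} w {0})"
    using card_Diff_subset[OF finite_subset[OF sub fin] sub] cp by simp
  moreover have "card (avoiding k {1..n} w {0}) \<le> fact n"
    using card_mono[OF fin sub] cp by simp
  ultimately have "real (card (fixing_perms n k)) = fact n - real (card (avoiding k {1..n} w {0}))"
    by (simp add: of_nat_diff)
  then show ?thesis unfolding i_prop_def cp 1 by (simp add: field_simps)
qed

section \<open>Forbidding short cycles and passing to the limit\<close>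

lemma avoid_prob_bounds: "0 \<le> avoid_prob k m n A \<and> avoid_prob k m n A \<le> 1"
proof (induction n arbitrary: A rule: less_induct)
  case (less n)
  show ?case
  proof (cases "n = 0")
    case False
    have *: "0 \<le> avoid_prob k m (n - j) (shift_union j A) \<and> avoid_prob k m (n - j) (shift_union j A) \<le> 1"
      if "j \<in> {m<..n}" for j using less.IH[of "n - j"] that False by auto
    have "(\<Sum>j\<in>{m<..n}. avoid_prob k m (n - j) (shift_union j A)) \<le> (\<Sum>j\<in>{m<..n}. 1)"
      using * by (intro sum_mono) auto
    also have "\<dots> \<le> n" by simp
    finally have "(\<Sum>j\<in>{m<..n}. avoid_prob k m (n - j) (shift_union j A)) \<le> n" .
    moreover have "(\<Sum>j\<in>{m<..n}. avoid_prob k m (n - j) (shift_union j A)) \<ge> 0"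
      using * by (intro sum_nonneg) auto
    ultimately show ?thesis using False by (simp add: avoid_prob.simps[of k m n])
  qed (simp add: avoid_prob_0)
qed

lemma avoid_prob_abs_le: "\<bar>avoid_prob k m n A\<bar> \<le> 1"
  using avoid_prob_bounds[of k m n A] by simp

lemma avoid_prob_unique:
  assumes "\<And>A. X 0 A = of_bool (k \<notin> A)"
    and "\<And>n A. real n * X n A = (\<Sum>j\<in>{m<..n}. X (n - j) (shift_union j A))"
  shows "X n A = avoid_prob k m n A"
proof (induction n arbitrary: A rule: less_induct)
  case (less n)
  show ?case
  proof (cases "n = 0")
    case False
    have "real n * X n A = real n * avoid_prob k m n A"
      unfolding assms(2) avoid_prob_rec by (intro sum.cong refl less.IH) (use False in auto)
    then show ?thesis using False by simp
  qed (simp add: assms(1) avoid_prob_0)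
qed

text \<open>
  For \<open>z = 1\<close> the number \<open>c\<close> counts additional cycles of length \<open>m\<close>, each of which joins the
  translate by \<open>m\<close> to the set of partial sums; \<open>z = -1\<close> gives the inverse operation.
\<close>

definition insert_cycles :: "real \<Rightarrow> nat \<Rightarrow> (nat \<Rightarrow> nat set \<Rightarrow> real) \<Rightarrow> nat \<Rightarrow> nat set \<Rightarrow> real" where
  "insert_cycles z m f n A =
     (\<Sum>c\<le>n div m. z ^ c / (real m ^ c * fact c) * f (n - m * c) ((shift_union m ^^ c) A))"

lemma shift_union_funpow_comm:
  "(shift_union m ^^ c) (shift_union j A) = shift_union j ((shift_union m ^^ c) A)"
  by (induction c) (simp_all add: shift_union_comm[of m j])

text \<open>
  Split the factor \<open>n\<close> as \<open>(n - m c) + m c\<close>. The first part lets the recursion of \<open>f\<close> act, and the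
  second part cancels against the coefficient and leaves the same sum with \<open>c - 1\<close> cycles.
\<close>

lemma insert_cycles_rec:
  assumes m: "m > 0"
    and f: "\<And>n A. real n * f n A = (\<Sum>j\<in>{l<..n}. f (n - j) (shift_union j A))"
  shows "real n * insert_cycles z m f n A =
    (\<Sum>j\<in>{l<..n}. insert_cycles z m f (n - j) (shift_union j A)) +
    (if m \<le> n then z * insert_cycles z m f (n - m) (shift_union m A) else 0)"
proof -
  define b where "b c = z ^ c / (real m ^ c * fact c)" for c
  define F where "F n c A = f (n - m * c) ((shift_union m ^^ c) A)" for n c A
  have le: "m * c \<le> n \<longleftrightarrow> c \<le> n div m" for c n
    using m by (simp add: less_eq_div_iff_mult_less_eq mult.commute)
  have split: "real n * (b c * F n c A) =
      b c * (\<Sum>j\<in>{l<..n - m * c}. f (n - m * c - j) (shift_union j ((shift_union m ^^ c) A))) +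
      b c * (real (m * c) * F n c A)" if "c \<le> n div m" for c
  proof -
    have "real n = real (n - m * c) + real (m * c)" using that le by (simp add: of_nat_diff)
    then show ?thesis unfolding F_def f[symmetric] by (simp add: algebra_simps)
  qed
  have 1: "(\<Sum>c\<le>n div m. b c * (\<Sum>j\<in>{l<..n - m * c}. f (n - m * c - j) (shift_union j ((shift_union m ^^ c) A))))
    = (\<Sum>j\<in>{l<..n}. insert_cycles z m f (n - j) (shift_union j A))"
  proof -
    have "(\<Sum>c\<le>n div m. b c * (\<Sum>j\<in>{l<..n - m * c}. f (n - m * c - j) (shift_union j ((shift_union m ^^ c) A))))
      = (\<Sum>(c,j)\<in>(SIGMA c:{..n div m}. {l<..n - m * c}). b c * f (n - m * c - j) (shift_union j ((shift_union m ^^ c) A)))"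
      by (simp add: sum_distrib_left sum.Sigma)
    also have "\<dots> = (\<Sum>(j,c)\<in>(SIGMA j:{l<..n}. {..(n - j) div m}). b c * F (n - j) c (shift_union j A))"
    proof (rule sum.reindex_bij_witness[where i = "\<lambda>(j,c). (c,j)" and j = "\<lambda>(c,j). (j,c)"], goal_cases)
      case (2 x)
      then show ?case by (auto simp: le[symmetric])
    next
      case (4 x)
      then show ?case by (auto simp: le[symmetric])
    next
      case (5 x)
      then show ?case by (auto simp: F_def shift_union_funpow_comm diff_commute add.commute)
    qed auto
    also have "\<dots> = (\<Sum>j\<in>{l<..n}. insert_cycles z m f (n - j) (shift_union j A))"
      by (simp add: sum.Sigma insert_cycles_def b_def F_def)
    finally show ?thesis .
  qed
  have 2: "(\<Sum>c\<le>n div m. b c * (real (m * c) * F n c A)) =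
    (if m \<le> n then z * insert_cycles z m f (n - m) (shift_union m A) else 0)"
  proof (cases "m \<le> n")
    case True
    then have nm: "n div m = Suc ((n - m) div m)" using m by (simp add: le_div_geq)
    have coeff: "b (Suc c) * real (m * Suc c) = z * b c" for c
    proof -
      have "fact (Suc c) = (real c + 1) * fact c" by (simp add: algebra_simps)
      then show ?thesis using m unfolding b_def by (simp add: divide_simps del: of_nat_Suc fact_Suc) (simp add: algebra_simps)
    qed
    have FS: "F n (Suc c) A = F (n - m) c (shift_union m A)" for c
      by (simp add: F_def shift_union_funpow_comm)
    have "(\<Sum>c\<le>n div m. b c * (real (m * c) * F n c A)) =
      (\<Sum>c\<le>(n - m) div m. b (Suc c) * (real (m * Suc c) * F n (Suc c) A))"
      unfolding nm by (subst sum.atMost_Suc_shift) simp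
    also have "\<dots> = (\<Sum>c\<le>(n - m) div m. z * (b c * F (n - m) c (shift_union m A)))"
      by (rule sum.cong) (simp_all only: FS mult.assoc[symmetric] coeff)
    also have "\<dots> = z * insert_cycles z m f (n - m) (shift_union m A)"
      by (simp add: insert_cycles_def b_def F_def sum_distrib_left)
    finally show ?thesis using True by simp
  next
    case False
    then have "n div m = 0" by simp
    then show ?thesis using False by simp
  qed
  have "real n * insert_cycles z m f n A = (\<Sum>c\<le>n div m. real n * (b c * F n c A))"
    by (simp add: insert_cycles_def b_def F_def sum_distrib_left)
  also have "\<dots> = (\<Sum>c\<le>n div m. b c * (\<Sum>j\<in>{l<..n - m * c}. f (n - m * c - j) (shift_union j ((shift_union m ^^ c) A))))
     + (\<Sum>c\<le>n div m. b c * (real (m * c) * F n c A))"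
    unfolding sum.distrib[symmetric] by (intro sum.cong split) auto
  finally show ?thesis unfolding 1 2 .
qed

lemma greaterThanAtMost_Suc_split:
  "(\<Sum>j\<in>{m<..n}. h j) = (if Suc m \<le> n then h (Suc m) else 0) + (\<Sum>j\<in>{Suc m<..n}. h j)"
  for h :: "nat \<Rightarrow> real"
proof (cases "Suc m \<le> n")
  case True
  then have "{m<..n} = insert (Suc m) {Suc m<..n}" by auto
  then show ?thesis using True by simp
qed simp

lemma avoid_prob_insert_cycles:
  "avoid_prob k m n A = insert_cycles 1 (Suc m) (avoid_prob k (Suc m)) n A"
proof (rule avoid_prob_unique[symmetric])
  show "real n * insert_cycles 1 (Suc m) (avoid_prob k (Suc m)) n A =
    (\<Sum>j\<in>{m<..n}. insert_cycles 1 (Suc m) (avoid_prob k (Suc m)) (n - j) (shift_union j A))" for n A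
    by (subst insert_cycles_rec[OF _ avoid_prob_rec]) (simp_all add: greaterThanAtMost_Suc_split[of _ m])
qed (simp add: insert_cycles_def avoid_prob_0)

lemma avoid_prob_remove_cycles:
  "avoid_prob k (Suc m) n A = insert_cycles (-1) (Suc m) (avoid_prob k m) n A"
proof (rule avoid_prob_unique[symmetric])
  show "real n * insert_cycles (-1) (Suc m) (avoid_prob k m) n A =
    (\<Sum>j\<in>{Suc m<..n}. insert_cycles (-1) (Suc m) (avoid_prob k m) (n - j) (shift_union j A))" for n A
    by (subst insert_cycles_rec[OF _ avoid_prob_rec]) (simp_all add: greaterThanAtMost_Suc_split[of _ m])
qed (simp add: insert_cycles_def avoid_prob_0)

text \<open>
  Tannery's theorem with the dominating series \<open>1 / c!\<close>.
\<close>

lemma insert_cycles_tendsto: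
  assumes m: "m > 0" and z: "\<bar>z\<bar> = 1"
    and bound: "\<And>n A. \<bar>f n A\<bar> \<le> 1"
    and lim: "\<And>A. (\<lambda>n. f n A) \<longlonglongrightarrow> g A"
  shows "(\<lambda>n. insert_cycles z m f n A) \<longlonglongrightarrow>
    (\<Sum>c. z ^ c / (real m ^ c * fact c) * g ((shift_union m ^^ c) A))"
proof -
  define b where "b c = z ^ c / (real m ^ c * fact c)" for c
  define a where "a c n = (if m * c \<le> n then b c * f (n - m * c) ((shift_union m ^^ c) A) else 0)" for c n
  have le: "m * c \<le> n \<longleftrightarrow> c \<le> n div m" for c n
    using m by (simp add: less_eq_div_iff_mult_less_eq mult.commute)
  have b: "\<bar>b c\<bar> \<le> 1 / fact c" for c
  proof -
    have "1 \<le> real m ^ c" using m by (intro one_le_power) simp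
    then have "fact c \<le> real m ^ c * fact c" by simp
    then have "1 / (real m ^ c * fact c) \<le> 1 / fact c"
      by (intro divide_left_mono) (use m in auto)
    moreover have "\<bar>b c\<bar> = 1 / (real m ^ c * fact c)" using z by (simp add: b_def abs_mult power_abs)
    ultimately show ?thesis by simp
  qed
  have a_sum: "(\<Sum>c. a c n) = insert_cycles z m f n A" for n
  proof -
    have "(\<Sum>c. a c n) = (\<Sum>c\<in>{..n div m}. a c n)"
      by (rule suminf_finite) (auto simp: a_def le)
    also have "\<dots> = insert_cycles z m f n A"
      by (auto simp: insert_cycles_def a_def b_def le intro!: sum.cong)
    finally show ?thesis .
  qed
  have "(\<lambda>n. \<Sum>c. a c n) \<longlonglongrightarrow> (\<Sum>c. b c * g ((shift_union m ^^ c) A))"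
  proof (rule tannerys_theorem[THEN conjunct2, THEN conjunct2])
    show "(\<lambda>n. a c n) \<longlonglongrightarrow> b c * g ((shift_union m ^^ c) A)" for c
      by (rule LIMSEQ_offset[of _ "m * c"]) (auto simp: a_def intro!: tendsto_intros lim)
    show "eventually (\<lambda>(c, n). norm (a c n) \<le> 1 / fact c) (at_top \<times>\<^sub>F sequentially)"
    proof (intro always_eventually allI, clarify)
      fix c n
      have "\<bar>b c\<bar> * \<bar>f (n - m * c) ((shift_union m ^^ c) A)\<bar> \<le> 1 / fact c * 1"
        using b bound by (intro mult_mono) auto
      then show "norm (a c n) \<le> 1 / fact c" by (simp add: a_def abs_mult)
    qed
    show "summable (\<lambda>c. 1 / fact c :: real)" using summable_exp[of "1 :: real"] by (simp add: field_simps)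
  qed simp
  then show ?thesis by (simp add: a_sum b_def)
qed

lemma suminf_exp_series:
  "(\<Sum>c. x ^ c / (y ^ c * fact c) * L) = exp (x / y) * (L :: real)"
proof -
  have "(\<lambda>c. (x / y) ^ c /\<^sub>R fact c) sums exp (x / y)" by (rule exp_converges)
  then have "(\<lambda>c. ((x / y) ^ c /\<^sub>R fact c) * L) sums (exp (x / y) * L)" by (rule sums_mult2)
  moreover have "((x / y) ^ c /\<^sub>R fact c) * L = x ^ c / (y ^ c * fact c) * L" for c
    by (simp add: power_divide field_simps)
  ultimately show ?thesis by (simp add: sums_iff)
qed

text \<open>
  The term for \<open>i = 0\<close> is \<open>1 / 0 = 0\<close>.
\<close>

definition harmonic :: "nat \<Rightarrow> real" where "harmonic m = (\<Sum>i\<le>m. 1 / real i)"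

lemma shift_union_empty [simp]: "shift_union m {} = {}" "(shift_union m ^^ c) {} = {}"
  by (simp_all add: shift_union_def, induction c) (simp_all add: shift_union_def)

text \<open>
  With \<open>A = {}\<close> only the condition on the cycle lengths is left. It is trivial for \<open>m = 0\<close>, and
  forbidding the length \<open>m + 1\<close> multiplies the limit by \<open>exp (- 1 / (m + 1))\<close>.
\<close>

lemma avoid_prob_empty_tendsto: "(\<lambda>n. avoid_prob k m n {}) \<longlonglongrightarrow> exp (- harmonic m)"
proof (induction m)
  case 0
  have "avoid_prob k 0 n {} = 1" for n
  proof (induction n rule: less_induct)
    case (less n)
    then have "(\<Sum>j\<in>{0<..n}. avoid_prob k 0 (n - j) {}) = (\<Sum>j\<in>{0<..n}. 1)"
      by (intro sum.cong) auto
    then show ?case by (cases "n = 0") (simp_all add: avoid_prob.simps[of k 0 n] avoid_prob_0)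
  qed
  then show ?case by (simp add: harmonic_def)
next
  case (Suc m)
  have "(\<lambda>n. insert_cycles (-1) (Suc m) (\<lambda>n A. avoid_prob k m n {}) n {}) \<longlonglongrightarrow>
    (\<Sum>c. (-1) ^ c / (real (Suc m) ^ c * fact c) * exp (- harmonic m))"
    by (rule insert_cycles_tendsto[where g = "\<lambda>_. exp (- harmonic m)"]) (simp_all add: avoid_prob_abs_le Suc)
  also have "(\<lambda>n. insert_cycles (-1) (Suc m) (\<lambda>n A. avoid_prob k m n {}) n {}) = (\<lambda>n. avoid_prob k (Suc m) n {})"
    unfolding avoid_prob_remove_cycles by (simp add: insert_cycles_def)
  also have "(\<Sum>c. (-1) ^ c / (real (Suc m) ^ c * fact c) * exp (- harmonic m)) = exp (- harmonic (Suc m))"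
    unfolding suminf_exp_series by (simp add: harmonic_def exp_add[symmetric])
  finally show ?case .
qed

lemma avoid_prob_long_cycles: "avoid_prob k k n A = of_bool (k \<notin> A) * avoid_prob k k n {}"
proof (rule avoid_prob_unique[symmetric])
  show "real n * (of_bool (k \<notin> A) * avoid_prob k k n {}) =
    (\<Sum>j\<in>{k<..n}. of_bool (k \<notin> shift_union j A) * avoid_prob k k (n - j) {})" for n A
  proof -
    have "(\<Sum>j\<in>{k<..n}. of_bool (k \<notin> shift_union j A) * avoid_prob k k (n - j) {}) =
      (\<Sum>j\<in>{k<..n}. of_bool (k \<notin> A) * avoid_prob k k (n - j) {})"
      by (intro sum.cong) (auto simp: shift_union_def)
    also have "\<dots> = of_bool (k \<notin> A) * (real n * avoid_prob k k n {})"
      unfolding avoid_prob_rec by (simp add: sum_distrib_left)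
    finally show ?thesis by simp
  qed
qed (simp add: avoid_prob_0)

text \<open>
  The index \<open>i\<close> counts the lengths that are still to be treated, in the order \<open>k - i + 1, \<dots>, k\<close>;
  the lengths up to \<open>k - i\<close> have been used to build \<open>A\<close>.
\<close>

fun avoid_lim :: "nat \<Rightarrow> nat \<Rightarrow> nat set \<Rightarrow> real" where
  "avoid_lim k 0 A = of_bool (k \<notin> A) * exp (- harmonic k)"
| "avoid_lim k (Suc i) A =
     (\<Sum>c. 1 / (real (k - i) ^ c * fact c) * avoid_lim k i ((shift_union (k - i) ^^ c) A))"

lemma avoid_prob_tendsto: "i \<le> k \<Longrightarrow> (\<lambda>n. avoid_prob k (k - i) n A) \<longlonglongrightarrow> avoid_lim k i A"
proof (induction i arbitrary: A)
  case 0
  have "(\<lambda>n. of_bool (k \<notin> A) * avoid_prob k k n {}) \<longlonglongrightarrow> of_bool (k \<notin> A) * exp (- harmonic k)"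
    by (rule tendsto_mult_left[OF avoid_prob_empty_tendsto])
  then show ?case by (simp only: avoid_prob_long_cycles[of k _ A, symmetric] diff_zero avoid_lim.simps)
next
  case (Suc i)
  have Suc_eq: "Suc (k - Suc i) = k - i" using Suc.prems by simp
  have "(\<lambda>n. insert_cycles 1 (k - i) (avoid_prob k (k - i)) n A) \<longlonglongrightarrow>
    (\<Sum>c. 1 ^ c / (real (k - i) ^ c * fact c) * avoid_lim k i ((shift_union (k - i) ^^ c) A))"
    by (rule insert_cycles_tendsto[where g = "avoid_lim k i"]) (use Suc in \<open>simp_all add: avoid_prob_abs_le\<close>)
  then show ?case using avoid_prob_insert_cycles[of k "k - Suc i"] by (simp add: Suc_eq)
qed

lemma avoid_lim_bounds:
  assumes "i \<le> k" shows "0 \<le> avoid_lim k i A" "avoid_lim k i A \<le> 1"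
proof -
  show "0 \<le> avoid_lim k i A"
    by (rule LIMSEQ_le_const[OF avoid_prob_tendsto[OF assms]]) (simp add: avoid_prob_bounds)
  show "avoid_lim k i A \<le> 1"
    by (rule LIMSEQ_le_const2[OF avoid_prob_tendsto[OF assms]]) (simp add: avoid_prob_bounds)
qed

lemma i_infty_eq: "i_infty k = 1 - avoid_lim k k {0}"
proof -
  have "(\<lambda>n. 1 - avoid_prob k 0 n {0}) \<longlonglongrightarrow> 1 - avoid_lim k k {0}"
    by (rule tendsto_diff[OF tendsto_const]) (use avoid_prob_tendsto[of k k "{0}"] in simp)
  moreover have "\<forall>\<^sub>F n in sequentially. 1 - avoid_prob k 0 n {0} = i_prop n k"
    using eventually_gt_at_top[of 0] by eventually_elim (simp add: i_prop_eq)
  ultimately have "(\<lambda>n. i_prop n k) \<longlonglongrightarrow> 1 - avoid_lim k k {0}"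
    by (rule Lim_transform_eventually)
  then show ?thesis unfolding i_infty_def by (rule limI)
qed

section \<open>The limit as a recursion on finite states\<close>

lemma fact_ratio_le: "fact c / fact (c + l) \<le> (1 :: real) / fact l"
proof -
  have "fact c * fact l \<le> (fact (c + l) :: real)"
    using dvd_imp_le[OF fact_fact_dvd_fact[of c l]] 
    by (metis fact_gt_zero of_nat_fact of_nat_le_iff of_nat_mult)
  then show ?thesis by (simp add: field_simps)
qed

text \<open>
  The contributions of at least \<open>c\<close> cycles of length \<open>k - i\<close> to \<open>avoid_lim k (Suc i)\<close>, as seen from
  the partial sums \<open>A\<close> reached with exactly \<open>c\<close> of them, and divided by the weight
  \<open>1 / ((k - i)^c c!)\<close> of these \<open>c\<close> cycles.
\<close>

definition cycle_tail :: "nat \<Rightarrow> nat \<Rightarrow> nat \<Rightarrow> nat set \<Rightarrow> real" where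
  "cycle_tail k i c A = (\<Sum>l. fact c / (real (k - i) ^ l * fact (c + l)) *
     avoid_lim k i ((shift_union (k - i) ^^ l) A))"

lemma cycle_tail_summable:
  assumes "i < k"
  shows "summable (\<lambda>l. fact c / (real (k - i) ^ l * fact (c + l)) * avoid_lim k i ((shift_union (k - i) ^^ l) A))"
proof (rule summable_comparison_test')
  show "summable (\<lambda>l. 1 / fact l :: real)" using summable_exp[of "1 :: real"] by (simp add: field_simps)
  fix l
  have "1 \<le> real (k - i) ^ l" by (intro one_le_power) (use assms in auto)
  then have "fact c / fact (c + l) / real (k - i) ^ l \<le> fact c / fact (c + l) / (1::real)"
    by (intro divide_left_mono) (use assms in auto)
  also have "\<dots> \<le> 1 / fact l" using fact_ratio_le[of c l] by simp
  finally have 1: "fact c / (real (k - i) ^ l * fact (c + l)) \<le> 1 / fact l" by (simp add: field_simps)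
  have "fact c / (real (k - i) ^ l * fact (c + l)) * avoid_lim k i ((shift_union (k - i) ^^ l) A) \<le> 1 / fact l * 1"
    using assms by (intro mult_mono 1 avoid_lim_bounds) auto
  then show "norm (fact c / (real (k - i) ^ l * fact (c + l)) * avoid_lim k i ((shift_union (k - i) ^^ l) A)) \<le> 1 / fact l"
    using avoid_lim_bounds(1)[of i k "(shift_union (k - i) ^^ l) A"] assms by (simp add: abs_mult)
qed

lemma cycle_tail_0: "cycle_tail k i 0 A = avoid_lim k (Suc i) A"
  by (simp add: cycle_tail_def)

lemma cycle_tail_rec:
  assumes "i < k"
  shows "cycle_tail k i c A =
    avoid_lim k i A + cycle_tail k i (Suc c) (shift_union (k - i) A) / real ((k - i) * Suc c)"
proof -
  define m where "m = k - i"
  define F where "F c l A = fact c / (real m ^ l * fact (c + l)) * avoid_lim k i ((shift_union m ^^ l) A)" for c l A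
  have m: "m > 0" using assms by (simp add: m_def)
  have summ: "summable (\<lambda>l. F c l A)" for c A
    using cycle_tail_summable[OF assms] by (simp add: F_def m_def)
  have shift: "F c (Suc l) A = F (Suc c) l (shift_union m A) / real (m * Suc c)" for l
  proof -
    have "fact c / (real m ^ Suc l * fact (c + Suc l)) =
      fact (Suc c) / (real m ^ l * fact (Suc c + l)) / real (m * Suc c)"
    proof -
      have "a / (mm * p * F) = x * a / (p * F) / (mm * x)" if "x \<noteq> 0" for a mm p F x :: real
        using that by (simp add: field_simps)
      from this[of "real (Suc c)" "fact c" "real m" "real m ^ l" "fact (c + Suc l)"]
      show ?thesis by (simp only: power_Suc fact_Suc[of c] of_nat_mult add_Suc_shift)
    qed
    moreover have "(shift_union m ^^ Suc l) A = (shift_union m ^^ l) (shift_union m A)"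
      by (simp only: funpow_Suc_right o_apply)
    ultimately show ?thesis unfolding F_def by (simp only: times_divide_eq_left)
  qed
  have "cycle_tail k i c A = (\<Sum>l. F c l A)" by (simp add: cycle_tail_def F_def m_def)
  also have "\<dots> = F c 0 A + (\<Sum>l. F c (Suc l) A)"
    using suminf_split_head[OF summ[of c A]] by simp
  also have "(\<Sum>l. F c (Suc l) A) = (\<Sum>l. F (Suc c) l (shift_union m A)) / real (m * Suc c)"
    unfolding shift by (rule suminf_divide[OF summ])
  finally show ?thesis by (simp add: cycle_tail_def F_def m_def)
qed

lemma cycle_tail_nonneg: "i < k \<Longrightarrow> 0 \<le> cycle_tail k i c A"
  unfolding cycle_tail_def
  by (intro suminf_nonneg cycle_tail_summable mult_nonneg_nonneg avoid_lim_bounds) auto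

lemma avoid_lim_hit: "k \<in> A \<Longrightarrow> avoid_lim k i A = 0"
proof (induction i arbitrary: A)
  case (Suc i)
  have "k \<in> (shift_union (k - i) ^^ c) A" for c
    using Suc.prems by (induction c) (auto simp: shift_union_def)
  then show ?case using Suc.IH by simp
qed simp

lemma cycle_tail_hit: "k \<in> A \<Longrightarrow> cycle_tail k i c A = 0"
proof -
  assume "k \<in> A"
  then have "k \<in> (shift_union (k - i) ^^ l) A" for l
    by (induction l) (auto simp: shift_union_def)
  then show ?thesis by (simp add: cycle_tail_def avoid_lim_hit)
qed

lemma avoid_lim_antimono:
  "i \<le> k \<Longrightarrow> A \<subseteq> B \<Longrightarrow> avoid_lim k i B \<le> avoid_lim k i A"
proof (induction i arbitrary: A B)
  case (Suc i)
  have sub: "(shift_union (k - i) ^^ l) A \<subseteq> (shift_union (k - i) ^^ l) B" for l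
    using Suc.prems(2) by (induction l) (auto simp: shift_union_def)
  show ?case unfolding cycle_tail_0[symmetric] unfolding cycle_tail_def
    using Suc.prems(1) Suc.IH[OF _ sub]
    by (intro suminf_le cycle_tail_summable mult_left_mono) auto
qed auto

text \<open>
  Partial sums \<open>x\<close> with \<open>i \<le> x < k\<close> are too large to be completed to \<open>k\<close> by a cycle longer than
  \<open>k - i\<close>.
\<close>

definition same_state :: "nat \<Rightarrow> nat \<Rightarrow> nat set \<Rightarrow> nat set \<Rightarrow> bool" where
  "same_state k i A B \<longleftrightarrow> (\<forall>x. x < i \<or> x = k \<longrightarrow> (x \<in> A \<longleftrightarrow> x \<in> B))"

lemma same_state_mono: "same_state k (Suc i) A B \<Longrightarrow> same_state k i A B"
  by (auto simp: same_state_def)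

lemma same_state_shift_union:
  assumes "i < k" "same_state k (Suc i) A B"
  shows "same_state k (Suc i) (shift_union (k - i) A) (shift_union (k - i) B)"
proof -
  have *: "x \<in> shift_union m C \<longleftrightarrow> x \<in> C \<or> (m \<le> x \<and> x - m \<in> C)" for x m C
    unfolding shift_union_def by (force simp: image_iff)
  have "k - (k - i) = i" using assms(1) by simp
  then show ?thesis using assms unfolding same_state_def * by (metis diff_le_self le_less_trans lessI)
qed

lemma same_state_funpow:
  assumes "i < k" "same_state k (Suc i) A B"
  shows "same_state k (Suc i) ((shift_union (k - i) ^^ l) A) ((shift_union (k - i) ^^ l) B)"
  using assms(2) by (induction l) (auto intro: same_state_shift_union assms(1))

lemma avoid_lim_cong: "i \<le> k \<Longrightarrow> same_state k i A B \<Longrightarrow> avoid_lim k i A = avoid_lim k i B"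
proof (induction i arbitrary: A B)
  case 0
  then show ?case by (simp add: same_state_def)
next
  case (Suc i)
  have "avoid_lim k i ((shift_union (k - i) ^^ l) A) = avoid_lim k i ((shift_union (k - i) ^^ l) B)" for l
    by (rule Suc.IH[OF _ same_state_mono[OF same_state_funpow]]) (use Suc.prems in auto)
  then show ?case by simp
qed

lemma cycle_tail_cong:
  assumes "i < k" "same_state k (Suc i) A B"
  shows "cycle_tail k i c A = cycle_tail k i c B"
proof -
  have "avoid_lim k i ((shift_union (k - i) ^^ l) A) = avoid_lim k i ((shift_union (k - i) ^^ l) B)" for l
    by (rule avoid_lim_cong[OF _ same_state_mono[OF same_state_funpow]]) (use assms in auto)
  then show ?thesis by (simp add: cycle_tail_def)
qed

lemma power_mult_fact_le: "fact c * (real c) ^ l \<le> fact (c + l)"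
proof (induction l)
  case (Suc l)
  have "fact c * real c ^ Suc l = (fact c * real c ^ l) * real c" by simp
  also have "\<dots> \<le> fact (c + l) * real (Suc (c + l))" by (intro mult_mono Suc.IH) auto
  also have "\<dots> = fact (c + Suc l)" by (simp add: mult.commute del: of_nat_Suc of_nat_add)
  finally show ?case .
qed simp

text \<open>
  More cycles can only lower the probability of avoidance, so the tail is dominated by a geometric
  series with ratio \<open>1 / ((k - i) (c + 1))\<close>. Replacing the last divisor by its predecessor therefore
  accounts for all further cycles.
\<close>

lemma cycle_tail_le:
  assumes i: "i < k" and y: "(k - i) * Suc c \<ge> 2"
  shows "cycle_tail k i (Suc c) A / real ((k - i) * Suc c) \<le> avoid_lim k i A / real ((k - i) * Suc c - 1)"
proof -
  define m where "m = k - i"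
  define y where "y = real (m * Suc c)"
  define F where "F l = fact (Suc c) / (real m ^ l * fact (Suc c + l)) * avoid_lim k i ((shift_union m ^^ l) A)" for l
  have m: "m > 0" and y1: "y > 1" using i assms(2) by (auto simp: m_def y_def simp del: of_nat_mult mult_Suc_right)
  have summ: "summable F" using cycle_tail_summable[OF i, of "Suc c" A] by (simp only: F_def[abs_def] m_def)
  have geo: "(\<lambda>l. avoid_lim k i A * (1 / y) ^ l) sums (avoid_lim k i A * (1 / (1 - 1 / y)))"
    using y1 by (intro sums_mult geometric_sums) simp
  have term_le: "F l \<le> avoid_lim k i A * (1 / y) ^ l" for l
  proof -
    have "fact (Suc c) * y ^ l = (fact (Suc c) * real (Suc c) ^ l) * real m ^ l"
      by (simp only: y_def of_nat_mult power_mult_distrib mult_ac)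
    also have "\<dots> \<le> fact (Suc c + l) * real m ^ l"
      by (intro mult_right_mono power_mult_fact_le) auto
    finally have "fact (Suc c) / (real m ^ l * fact (Suc c + l)) \<le> 1 / y ^ l"
      using m y1 by (simp add: divide_simps mult_ac del: fact_Suc add_Suc)
    moreover have "A \<subseteq> (shift_union m ^^ l) A" by (induction l) (auto simp: shift_union_def)
    ultimately have "F l \<le> 1 / y ^ l * avoid_lim k i A"
      unfolding F_def using i y1 by (intro mult_mono avoid_lim_antimono avoid_lim_bounds) auto
    then show ?thesis by (simp add: power_divide mult_ac)
  qed
  have "cycle_tail k i (Suc c) A = suminf F" by (simp add: cycle_tail_def F_def[abs_def] m_def)
  also have "\<dots> \<le> (\<Sum>l. avoid_lim k i A * (1 / y) ^ l)"
    by (intro suminf_le term_le summ sums_summable[OF geo])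
  also have "\<dots> = avoid_lim k i A * (1 / (1 - 1 / y))" using geo by (rule sums_unique[symmetric])
  finally have "cycle_tail k i (Suc c) A / y \<le> avoid_lim k i A * (1 / (1 - 1 / y)) / y"
    using y1 by (intro divide_right_mono) auto
  also have "\<dots> = avoid_lim k i A / (y - 1)" using y1 by (simp add: divide_simps)
  also have "y - 1 = real (m * Suc c - 1)" using y1 by (simp add: y_def of_nat_diff del: of_nat_mult mult_Suc_right)
  finally show ?thesis by (simp add: y_def m_def)
qed

definition sums_of :: "bool list \<Rightarrow> nat set" where
  "sums_of x = {s. s < length x \<and> x ! s}"

text \<open>
  The union with a translate, for characteristic lists. The queue \<open>q\<close> holds the entries that are
  still to be copied to later positions, so that a single pass suffices.
\<close>

fun or_shift :: "bool list \<Rightarrow> bool list \<Rightarrow> bool list" where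
  "or_shift q [] = []"
| "or_shift [] (b # x) = b # x"
| "or_shift (c # q) (b # x) = (b \<or> c) # or_shift (q @ [b]) x"

lemma length_or_shift [simp]: "length (or_shift q x) = length x"
  by (induction q x rule: or_shift.induct) auto

lemma nth_or_shift: "q \<noteq> [] \<Longrightarrow> s < length x \<Longrightarrow> or_shift q x ! s \<longleftrightarrow> x ! s \<or> (q @ x) ! s"
proof (induction q x arbitrary: s rule: or_shift.induct)
  case (3 c q b x)
  then show ?case by (cases s) auto
qed auto

lemma or_shift_same_state:
  assumes i: "i < k" and x: "length x = Suc i" "\<not> last x"
  shows "same_state k (Suc i) (shift_union (k - i) (sums_of x)) (sums_of (or_shift (replicate (k - i) False) x))"
  unfolding same_state_def
proof (intro allI impI)
  fix s assume s: "s < Suc i \<or> s = k"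
  have last: "last x = x ! i" using x by (metis diff_Suc_1 last_conv_nth list.size(3) nat.distinct(1))
  have mem: "s \<in> shift_union m C \<longleftrightarrow> s \<in> C \<or> (m \<le> s \<and> s - m \<in> C)" for m C
    unfolding shift_union_def by (force simp: image_iff)
  show "s \<in> shift_union (k - i) (sums_of x) \<longleftrightarrow> s \<in> sums_of (or_shift (replicate (k - i) False) x)"
  proof (cases "s < Suc i")
    case True
    then have "or_shift (replicate (k - i) False) x ! s \<longleftrightarrow> x ! s \<or> (k - i \<le> s \<and> x ! (s - (k - i)))"
      using i x by (subst nth_or_shift) (auto simp: nth_append)
    then show ?thesis using True x i by (auto simp: mem sums_of_def)
  next
    case False
    then have "s = k" using s by simp
    then show ?thesis unfolding mem using i x last by (auto simp: sums_of_def)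
  qed
qed

definition state_value :: "nat \<Rightarrow> nat \<Rightarrow> bool list \<Rightarrow> real" where
  "state_value k i x = avoid_lim k i (sums_of x)"

lemma state_value_butlast:
  assumes "i < k" "length x = Suc i"
  shows "avoid_lim k i (sums_of x) = state_value k i (butlast x)"
  unfolding state_value_def using assms
  by (intro avoid_lim_cong) (auto simp: same_state_def sums_of_def nth_butlast)

lemma cycle_tail_list:
  assumes i: "i < k" and x: "length x = Suc i"
  shows "cycle_tail k i c (sums_of x) = state_value k i (butlast x) +
    (if last x then 0 else cycle_tail k i (Suc c) (sums_of (or_shift (replicate (k - i) False) x)) / real ((k - i) * Suc c))"
proof (cases "last x")
  case True
  have "last x = x ! i" using x by (metis diff_Suc_1 last_conv_nth list.size(3) nat.distinct(1))
  then have "i \<in> sums_of x" using True x by (simp add: sums_of_def)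
  then have "i + (k - i) \<in> shift_union (k - i) (sums_of x)" by (auto simp: shift_union_def)
  then have "k \<in> shift_union (k - i) (sums_of x)" using i by simp
  then show ?thesis using True
    by (simp add: cycle_tail_rec[OF i, of c] state_value_butlast[OF i x] cycle_tail_hit)
next
  case False
  then show ?thesis
    by (simp add: cycle_tail_rec[OF i, of c] state_value_butlast[OF i x]
      cycle_tail_cong[OF i or_shift_same_state[OF i x False]])
qed

text \<open>
  The divisors \<open>m, 2 m, 3 m, \<dots>\<close> produce the weights \<open>1 / (m^c c!)\<close> one factor at a time. If the last
  entry of \<open>x\<close> is set, then one more cycle reaches \<open>k\<close> exactly and nothing more is contributed.
\<close>

fun level_sum :: "(bool list \<Rightarrow> real) \<Rightarrow> bool list \<Rightarrow> nat list \<Rightarrow> bool list \<Rightarrow> real" where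
  "level_sum f q [] x = f (butlast x)"
| "level_sum f q (d # ds) x = f (butlast x) + (if last x then 0 else level_sum f q ds (or_shift q x) / real d)"

lemma level_sum_le:
  assumes i: "i < k"
  shows "length x = Suc i \<Longrightarrow>
    level_sum (state_value k i) (replicate (k - i) False) (map (\<lambda>c. (k - i) * c) [Suc c..<Suc c + n]) x
      \<le> cycle_tail k i c (sums_of x)"
proof (induction n arbitrary: c x)
  case 0
  show ?case unfolding cycle_tail_list[OF i 0] by (simp add: cycle_tail_nonneg[OF i] del: of_nat_mult)
next
  case (Suc n)
  have upt: "[Suc c..<Suc c + Suc n] = Suc c # [Suc (Suc c)..<Suc (Suc c) + n]"
    by (simp add: upt_conv_Cons del: upt_Suc)
  show ?case unfolding upt cycle_tail_list[OF i Suc.prems]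
    using Suc.IH[of "or_shift (replicate (k - i) False) x" "Suc c"] Suc.prems
    by (auto intro!: divide_right_mono simp del: upt_Suc of_nat_mult mult_Suc_right)
qed

lemma level_sum_ge:
  assumes i: "i < k" 
  shows "length x = Suc i \<Longrightarrow> (k - i) * (Suc c + n) \<ge> 2 \<Longrightarrow>
    level_sum (state_value k i) (replicate (k - i) False)
      (map (\<lambda>c. (k - i) * c) [Suc c..<Suc c + n] @ [(k - i) * (Suc c + n) - 1]) x
      \<ge> cycle_tail k i c (sums_of x)"
proof (induction n arbitrary: c x)
  case 0
  define y where "y = or_shift (replicate (k - i) False) x"
  have "cycle_tail k i (Suc c) (sums_of y) / real ((k - i) * Suc c) \<le> state_value k i (butlast y) / real ((k - i) * Suc c - 1)"
    using cycle_tail_le[OF i, of c "sums_of y"] 0 state_value_butlast[OF i, of y] by (simp add: y_def)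
  then show ?case unfolding cycle_tail_list[OF i 0(1)] by (simp add: y_def)
next
  case (Suc n)
  have upt: "[Suc c..<Suc c + Suc n] = Suc c # [Suc (Suc c)..<Suc (Suc c) + n]"
    by (simp add: upt_conv_Cons del: upt_Suc)
  have e: "Suc c + Suc n = Suc (Suc c) + n" by simp
  show ?case unfolding upt cycle_tail_list[OF i Suc.prems(1)]
    using Suc.IH[of "or_shift (replicate (k - i) False) x" "Suc c"] Suc.prems unfolding e
    by (auto intro!: divide_right_mono simp del: upt_Suc of_nat_mult mult_Suc_right add_Suc)
qed

section \<open>Weighted tries of states with rounded weights\<close>

text \<open>
  Binary numbers with the least significant digit first. All operations on tries and numbers are
  designed for evaluation by rewriting alone, where one rewrite step handles one digit.
\<close>

datatype bits = BZ | B0 bits | B1 bits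

fun bits_val :: "bits \<Rightarrow> nat" where
  "bits_val BZ = 0"
| "bits_val (B0 x) = 2 * bits_val x"
| "bits_val (B1 x) = 2 * bits_val x + 1"

fun bits_inc :: "bits \<Rightarrow> bits" where
  "bits_inc BZ = B1 BZ"
| "bits_inc (B0 x) = B1 x"
| "bits_inc (B1 x) = B0 (bits_inc x)"

fun bits_add :: "bits \<Rightarrow> bits \<Rightarrow> bits" where
  "bits_add BZ y = y"
| "bits_add (B0 x) BZ = B0 x"
| "bits_add (B1 x) BZ = B1 x"
| "bits_add (B0 x) (B0 y) = B0 (bits_add x y)"
| "bits_add (B0 x) (B1 y) = B1 (bits_add x y)"
| "bits_add (B1 x) (B0 y) = B1 (bits_add x y)"
| "bits_add (B1 x) (B1 y) = B0 (bits_inc (bits_add x y))"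

fun bits_double :: "bits \<Rightarrow> bits" where
  "bits_double BZ = BZ"
| "bits_double (B0 x) = B0 (B0 x)"
| "bits_double (B1 x) = B0 (B1 x)"

datatype quotient = Quot bits nat

text \<open>
  Long division: the quotient and remainder of \<open>2 x + b\<close> by \<open>d\<close>, computed from those of \<open>x\<close>.
\<close>

fun div_step :: "bool \<Rightarrow> nat \<Rightarrow> quotient \<Rightarrow> quotient" where
  "div_step b d (Quot q r) =
     (let s = 2 * r + of_bool b in if s < d then Quot (bits_double q) s else Quot (B1 q) (s - d))"

fun bits_div :: "nat \<Rightarrow> bits \<Rightarrow> quotient" where
  "bits_div d BZ = Quot BZ 0"
| "bits_div d (B0 x) = div_step False d (bits_div d x)"
| "bits_div d (B1 x) = div_step True d (bits_div d x)"

fun rounded :: "bool \<Rightarrow> quotient \<Rightarrow> bits" where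
  "rounded False (Quot q r) = q"
| "rounded True (Quot q r) = bits_inc q"

lemma bits_val_inc [simp]: "bits_val (bits_inc x) = Suc (bits_val x)"
  by (induction x) auto

lemma bits_val_add [simp]: "bits_val (bits_add x y) = bits_val x + bits_val y"
  by (induction x y rule: bits_add.induct) auto

lemma bits_val_double [simp]: "bits_val (bits_double x) = 2 * bits_val x"
  by (cases x) auto

lemma bits_div_correct:
  assumes "d > 0"
  shows "\<exists>q r. bits_div d x = Quot q r \<and> bits_val x = d * bits_val q + r \<and> r < d"
proof (induction x)
  case BZ
  then show ?case using assms by simp
next
  case (B0 x)
  then obtain q r where "bits_div d x = Quot q r" "bits_val x = d * bits_val q + r" "r < d" by blast
  then show ?case by (auto simp: algebra_simps Let_def)
next
  case (B1 x)
  then obtain q r where "bits_div d x = Quot q r" "bits_val x = d * bits_val q + r" "r < d" by blast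
  then show ?case by (auto simp: algebra_simps Let_def)
qed

text \<open>
  Upper and lower bounds are produced by the same algorithm, and one relation with a flag serves
  both correctness proofs.
\<close>

definition rounds :: "bool \<Rightarrow> real \<Rightarrow> real \<Rightarrow> bool" where
  "rounds up a b \<longleftrightarrow> (if up then b \<le> a else a \<le> b)"

lemma rounds_refl [simp]: "rounds up a a" by (simp add: rounds_def)
lemma rounds_trans: "rounds up a b \<Longrightarrow> rounds up b c \<Longrightarrow> rounds up a c" by (auto simp: rounds_def)
lemma rounds_add: "rounds up a b \<Longrightarrow> rounds up c d \<Longrightarrow> rounds up (a + c) (b + d)" by (auto simp: rounds_def)
lemma rounds_mult_right: "rounds up a b \<Longrightarrow> 0 \<le> c \<Longrightarrow> rounds up (a * c) (b * c)"
  by (auto simp: rounds_def intro: mult_right_mono)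

lemma rounds_bits_div:
  assumes "d > 0"
  shows "rounds up (bits_val (rounded up (bits_div d x))) (bits_val x / d)"
proof -
  obtain q r where qr: "bits_div d x = Quot q r" "bits_val x = d * bits_val q + r" "r < d"
    using bits_div_correct[OF assms] by blast
  have "real (bits_val x) = real d * bits_val q + r" using qr(2) by simp
  then have "real (bits_val x) / d = bits_val q + r / d" using assms by (simp add: field_simps)
  moreover have "0 \<le> real r / d" "real r / d \<le> 1" using qr(3) by auto
  ultimately show ?thesis by (cases up) (auto simp: rounds_def qr(1))
qed

text \<open>
  A finite measure on boolean lists of one common length. The two numbers at a tip are the weights
  of the two possible last entries.
\<close>

datatype trie = Empty | Tip bits bits | Node trie trie

fun mk_node :: "trie \<Rightarrow> trie \<Rightarrow> trie" where
  "mk_node Empty Empty = Empty"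
| "mk_node Empty (Tip a b) = Node Empty (Tip a b)"
| "mk_node Empty (Node l r) = Node Empty (Node l r)"
| "mk_node (Tip a b) t = Node (Tip a b) t"
| "mk_node (Node l r) t = Node (Node l r) t"

fun mk_tip :: "bool \<Rightarrow> bits \<Rightarrow> trie" where
  "mk_tip c BZ = Empty"
| "mk_tip False (B0 w) = Tip (B0 w) BZ"
| "mk_tip False (B1 w) = Tip (B1 w) BZ"
| "mk_tip True (B0 w) = Tip BZ (B0 w)"
| "mk_tip True (B1 w) = Tip BZ (B1 w)"

fun merge :: "trie \<Rightarrow> trie \<Rightarrow> trie" where
  "merge Empty t = t"
| "merge (Tip a b) Empty = Tip a b"
| "merge (Node l r) Empty = Node l r"
| "merge (Tip a b) (Tip c d) = Tip (bits_add a c) (bits_add b d)"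
| "merge (Node l r) (Node l' r') = Node (merge l l') (merge r r')"
| "merge (Tip a b) (Node l r) = Empty"
| "merge (Node l r) (Tip a b) = Empty"

text \<open>
  Treats one additional cycle: every list \<open>x\<close> moves to \<open>or_shift q x\<close> and its weight is divided by
  \<open>d\<close>. Lists whose last entry is set reach \<open>k\<close> by this cycle, and their weight is discarded.
\<close>

fun shift_trie :: "bool \<Rightarrow> nat \<Rightarrow> bool list \<Rightarrow> trie \<Rightarrow> trie" where
  "shift_trie up d q Empty = Empty"
| "shift_trie up d (c # q) (Tip BZ b) = Empty"
| "shift_trie up d (c # q) (Tip (B0 a) b) = mk_tip c (rounded up (bits_div d (B0 a)))"
| "shift_trie up d (c # q) (Tip (B1 a) b) = mk_tip c (rounded up (bits_div d (B1 a)))"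
| "shift_trie up d (False # q) (Node l r) =
     mk_node (shift_trie up d (q @ [False]) l) (shift_trie up d (q @ [True]) r)"
| "shift_trie up d (True # q) (Node l r) =
     mk_node Empty (merge (shift_trie up d (q @ [False]) l) (shift_trie up d (q @ [True]) r))"
| "shift_trie up d [] t = Empty"

text \<open>
  After a length has been treated, the last entry of a state can no longer be completed to \<open>k\<close>;
  states that differ only there are identified.
\<close>

fun drop_last :: "trie \<Rightarrow> trie" where
  "drop_last Empty = Empty"
| "drop_last (Tip a b) = Empty"
| "drop_last (Node (Tip a b) Empty) = Tip (bits_add a b) BZ"
| "drop_last (Node (Tip a b) (Tip c d)) = Tip (bits_add a b) (bits_add c d)"
| "drop_last (Node (Tip a b) (Node l r)) = Empty"
| "drop_last (Node Empty Empty) = Empty"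
| "drop_last (Node Empty (Tip c d)) = Tip BZ (bits_add c d)"
| "drop_last (Node Empty (Node l r)) = Node Empty (drop_last (Node l r))"
| "drop_last (Node (Node l r) t) = Node (drop_last (Node l r)) (drop_last t)"

fun level :: "bool \<Rightarrow> bool list \<Rightarrow> nat list \<Rightarrow> trie \<Rightarrow> trie" where
  "level up q [] t = drop_last t"
| "level up q (d # ds) t = merge (drop_last t) (level up q ds (shift_trie up d q t))"

fun depth :: "nat \<Rightarrow> trie \<Rightarrow> bool" where
  "depth n Empty = True"
| "depth n (Tip a b) = (n = 1)"
| "depth n (Node l r) = (n > 1 \<and> depth (n - 1) l \<and> depth (n - 1) r)"

fun trie_sum :: "trie \<Rightarrow> (bool list \<Rightarrow> real) \<Rightarrow> real" where
  "trie_sum Empty f = 0"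
| "trie_sum (Tip a b) f = real (bits_val a) * f [False] + real (bits_val b) * f [True]"
| "trie_sum (Node l r) f = trie_sum l (\<lambda>x. f (False # x)) + trie_sum r (\<lambda>x. f (True # x))"

lemma trie_sum_mk_node [simp]: "trie_sum (mk_node l r) f = trie_sum (Node l r) f"
  by (cases "(l, r)" rule: mk_node.cases) auto

lemma depth_mk_node [simp]: "n > 1 \<Longrightarrow> depth n (mk_node l r) \<longleftrightarrow> depth (n - 1) l \<and> depth (n - 1) r"
  by (cases "(l, r)" rule: mk_node.cases) auto

lemma trie_sum_mk_tip [simp]: "trie_sum (mk_tip c w) f = real (bits_val w) * f [c]"
  by (cases "(c, w)" rule: mk_tip.cases) auto

lemma depth_mk_tip [simp]: "depth (Suc 0) (mk_tip c w)"
  by (cases "(c, w)" rule: mk_tip.cases) auto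

lemma depth_merge: "depth n s \<Longrightarrow> depth n t \<Longrightarrow> depth n (merge s t)"
  by (induction s t arbitrary: n rule: merge.induct) auto

lemma trie_sum_merge: "depth n s \<Longrightarrow> depth n t \<Longrightarrow> trie_sum (merge s t) f = trie_sum s f + trie_sum t f"
  by (induction s t arbitrary: n f rule: merge.induct) (fastforce simp: algebra_simps)+

lemma trie_sum_rounds:
  "depth n t \<Longrightarrow> (\<And>x. length x = n \<Longrightarrow> rounds up (f x) (g x)) \<Longrightarrow> rounds up (trie_sum t f) (trie_sum t g)"
proof (induction t arbitrary: n f g)
  case (Tip a b)
  then show ?case
    by (auto simp: mult.commute[of "real (bits_val _)"] intro!: rounds_add rounds_mult_right)
next
  case (Node l r)
  then show ?case by (auto intro!: rounds_add)
qed simp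

lemma trie_sum_cong:
  assumes "depth n t" "\<And>x. length x = n \<Longrightarrow> f x = g x"
  shows "trie_sum t f = trie_sum t g"
  using trie_sum_rounds[OF assms(1), of True f g] trie_sum_rounds[OF assms(1), of False f g] assms(2)
  by (simp add: rounds_def)

lemma trie_sum_add: "trie_sum t (\<lambda>x. f x + g x) = trie_sum t f + trie_sum t g"
  by (induction t arbitrary: f g) (simp_all add: algebra_simps)

lemma trie_sum_divide: "trie_sum t (\<lambda>x. f x / c) = trie_sum t f / c"
  by (induction t arbitrary: f) (simp_all add: add_divide_distrib)

lemma depth_drop_last: "depth n t \<Longrightarrow> n > 1 \<Longrightarrow> depth (n - 1) (drop_last t)"
  by (induction t arbitrary: n rule: drop_last.induct) (fastforce)+

lemma trie_sum_butlast_Cons: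
  assumes "depth n t" "n > 0"
  shows "trie_sum t (\<lambda>x. f (butlast (b # x))) = trie_sum t (\<lambda>x. f (b # butlast x))"
  by (rule trie_sum_cong[OF assms(1)]) (use assms(2) in auto)

lemma trie_sum_drop_last:
  "depth n t \<Longrightarrow> n > 1 \<Longrightarrow> trie_sum (drop_last t) f = trie_sum t (\<lambda>x. f (butlast x))"
proof (induction t arbitrary: n f rule: drop_last.induct)
  case (8 l r)
  then have d: "depth (n - 1) (Node l r)" "n - 1 > 1" by auto
  show ?case
    using "8.IH"[OF d] trie_sum_butlast_Cons[OF d(1), of f True] d(2) by simp
next
  case (9 l r t)
  then have d: "depth (n - 1) (Node l r)" "depth (n - 1) t" "n - 1 > 1" by auto
  show ?case
    using "9.IH"(1)[OF d(1,3)] "9.IH"(2)[OF d(2,3)] trie_sum_butlast_Cons[OF d(1), of f False]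
      trie_sum_butlast_Cons[OF d(2), of f True] d(3) by simp
qed (auto simp: algebra_simps)

lemma depth_shift_trie: "depth n t \<Longrightarrow> q \<noteq> [] \<Longrightarrow> depth n (shift_trie up d q t)"
proof (induction up d q t arbitrary: n rule: shift_trie.induct)
  case (5 up d q l r)
  then show ?case by auto
next
  case (6 up d q l r)
  then show ?case by (auto intro!: depth_merge)
qed auto

text \<open>
  The queue of \<open>or_shift\<close> depends only on the entries read so far, that is, on the path from the
  root. This is why a whole trie can be shifted in one traversal. If the head of the queue is set,
  both subtrees are sent to the same side and have to be merged.
\<close>

lemma shift_trie_rounds:
  "d > 0 \<Longrightarrow> depth n t \<Longrightarrow> q \<noteq> [] \<Longrightarrow> (\<And>x. 0 \<le> f x) \<Longrightarrow>
    rounds up (trie_sum (shift_trie up d q t) f)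
      (trie_sum t (\<lambda>x. if last x then 0 else f (or_shift q x)) / real d)"
proof (induction up d q t arbitrary: n f rule: shift_trie.induct)
  case (3 up d c q a b)
  have "rounds up (real (bits_val (rounded up (bits_div d (B0 a)))) * f [c]) (real (bits_val (B0 a)) / real d * f [c])"
    by (intro rounds_mult_right rounds_bits_div 3)
  then show ?case by simp
next
  case (4 up d c q a b)
  have "rounds up (real (bits_val (rounded up (bits_div d (B1 a)))) * f [c]) (real (bits_val (B1 a)) / real d * f [c])"
    by (intro rounds_mult_right rounds_bits_div 4)
  then show ?case by simp
next
  case (5 up d q l r)
  then have dl: "depth (n - 1) l" "depth (n - 1) r" "n - 1 > 0" by auto
  have eq: "trie_sum t (\<lambda>x. if last (b # x) then 0 else f (or_shift (False # q) (b # x))) =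
    trie_sum t (\<lambda>x. if last x then 0 else f (b # or_shift (q @ [b]) x))" if "depth (n - 1) t" for t b
    by (rule trie_sum_cong[OF that]) (use dl in auto)
  have "rounds up (trie_sum (shift_trie up d (q @ [False]) l) (\<lambda>x. f (False # x)))
      (trie_sum l (\<lambda>x. if last x then 0 else f (False # or_shift (q @ [False]) x)) / real d)"
    by (rule 5(1)[of "n - 1"]) (use dl 5 in auto)
  moreover have "rounds up (trie_sum (shift_trie up d (q @ [True]) r) (\<lambda>x. f (True # x)))
      (trie_sum r (\<lambda>x. if last x then 0 else f (True # or_shift (q @ [True]) x)) / real d)"
    by (rule 5(2)[of "n - 1"]) (use dl 5 in auto)
  ultimately show ?case
    by (simp only: shift_trie.simps trie_sum_mk_node trie_sum.simps eq[OF dl(1)] eq[OF dl(2)] add_divide_distrib rounds_add)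
next
  case (6 up d q l r)
  then have dl: "depth (n - 1) l" "depth (n - 1) r" "n - 1 > 0" by auto
  have eq: "trie_sum t (\<lambda>x. if last (b # x) then 0 else f (or_shift (True # q) (b # x))) =
    trie_sum t (\<lambda>x. if last x then 0 else f (True # or_shift (q @ [b]) x))" if "depth (n - 1) t" for t b
    by (rule trie_sum_cong[OF that]) (use dl in auto)
  have "rounds up (trie_sum (shift_trie up d (q @ [False]) l) (\<lambda>x. f (True # x)))
      (trie_sum l (\<lambda>x. if last x then 0 else f (True # or_shift (q @ [False]) x)) / real d)"
    by (rule 6(1)[of "n - 1"]) (use dl 6 in auto)
  moreover have "rounds up (trie_sum (shift_trie up d (q @ [True]) r) (\<lambda>x. f (True # x)))
      (trie_sum r (\<lambda>x. if last x then 0 else f (True # or_shift (q @ [True]) x)) / real d)"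
    by (rule 6(2)[of "n - 1"]) (use dl 6 in auto)
  moreover have "trie_sum (merge (shift_trie up d (q @ [False]) l) (shift_trie up d (q @ [True]) r)) (\<lambda>x. f (True # x)) =
    trie_sum (shift_trie up d (q @ [False]) l) (\<lambda>x. f (True # x)) + trie_sum (shift_trie up d (q @ [True]) r) (\<lambda>x. f (True # x))"
    by (rule trie_sum_merge[of "n - 1"]) (use dl in \<open>auto intro: depth_shift_trie\<close>)
  ultimately show ?case
    by (simp only: shift_trie.simps trie_sum_mk_node trie_sum.simps eq[OF dl(1)] eq[OF dl(2)] add_divide_distrib rounds_add add_0)
qed auto

lemma level_sum_nonneg: "(\<And>x. 0 \<le> f x) \<Longrightarrow> 0 \<le> level_sum f q ds x"
  by (induction f q ds x rule: level_sum.induct) auto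

lemma depth_level: "depth n t \<Longrightarrow> n > 1 \<Longrightarrow> q \<noteq> [] \<Longrightarrow> depth (n - 1) (level up q ds t)"
  by (induction ds arbitrary: t) (auto intro!: depth_merge depth_drop_last depth_shift_trie simp del: One_nat_def)

lemma level_rounds:
  assumes f: "\<And>x. 0 \<le> f x" and n: "n > 1" and q: "q \<noteq> []"
  shows "depth n t \<Longrightarrow> \<forall>d\<in>set ds. d > 0 \<Longrightarrow>
    rounds up (trie_sum (level up q ds t) f) (trie_sum t (level_sum f q ds))"
proof (induction ds arbitrary: t)
  case Nil
  then show ?case using n by (simp add: trie_sum_drop_last level_sum.simps[abs_def])
next
  case (Cons d ds)
  define s where "s = shift_trie up d q t"
  have s: "depth n s" unfolding s_def using Cons.prems(1) q by (rule depth_shift_trie)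
  have "rounds up (trie_sum (level up q ds s) f) (trie_sum s (level_sum f q ds))"
    by (rule Cons.IH[OF s]) (use Cons.prems in auto)
  moreover have "rounds up (trie_sum s (level_sum f q ds))
      (trie_sum t (\<lambda>x. if last x then 0 else level_sum f q ds (or_shift q x)) / real d)"
    unfolding s_def by (rule shift_trie_rounds[OF _ Cons.prems(1) q]) (use Cons.prems level_sum_nonneg[OF f] in auto)
  ultimately have "rounds up (trie_sum (level up q ds s) f)
      (trie_sum t (\<lambda>x. if last x then 0 else level_sum f q ds (or_shift q x)) / real d)"
    by (rule rounds_trans)
  then have "rounds up (trie_sum (drop_last t) f + trie_sum (level up q ds s) f)
      (trie_sum t (\<lambda>x. f (butlast x)) + trie_sum t (\<lambda>x. (if last x then 0 else level_sum f q ds (or_shift q x)) / real d))"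
    unfolding trie_sum_divide trie_sum_drop_last[OF Cons.prems(1) n, symmetric]
    by (intro rounds_add rounds_refl)
  moreover have "trie_sum (merge (drop_last t) (level up q ds s)) f = trie_sum (drop_last t) f + trie_sum (level up q ds s) f"
    by (rule trie_sum_merge[of "n - 1"]) (use n s q Cons.prems in \<open>auto intro: depth_drop_last depth_level simp del: One_nat_def\<close>)
  moreover have "level_sum f q (d # ds) = (\<lambda>x. f (butlast x) + (if last x then 0 else level_sum f q ds (or_shift q x)) / real d)"
    by (auto simp: fun_eq_iff)
  ultimately show ?case by (simp add: s_def trie_sum_add)
qed

section \<open>From integer weights to the inequality\<close>

text \<open>
  The number of cycles of length \<open>m\<close> after which the tail is cut off. Two suffice for long cycles,
  and more than \<open>k div m\<close> of them never create new partial sums; the bound \<open>3 + 9 div m\<close> cuts off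
  only weight that is negligible for the required precision.
\<close>

definition cycle_cap :: "nat \<Rightarrow> nat \<Rightarrow> nat" where
  "cycle_cap k m = min (max 2 (k div m)) (3 + 9 div m)"

text \<open>
  The upper bound diminishes the last divisor by one in order to cover the tail of the series.
\<close>

definition divisors :: "bool \<Rightarrow> nat \<Rightarrow> nat \<Rightarrow> nat list" where
  "divisors up k m = map (\<lambda>c. m * c) [1..<cycle_cap k m] @ [m * cycle_cap k m - of_bool up]"

fun levels :: "bool \<Rightarrow> nat \<Rightarrow> nat list \<Rightarrow> trie \<Rightarrow> trie" where
  "levels up k [] t = t"
| "levels up k (m # ms) t = levels up k ms (level up (replicate m False) (divisors up k m) t)"

fun path_trie :: "bool list \<Rightarrow> bits \<Rightarrow> trie" where
  "path_trie [] w = Empty"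
| "path_trie [b] w = mk_tip b w"
| "path_trie (b # c # x) w =
     (if b then Node Empty (path_trie (c # x) w) else Node (path_trie (c # x) w) Empty)"

text \<open>
  The scale \<open>2^20\<close> leaves rounding errors well below the gaps between neighbouring values.
\<close>

definition unit_weight :: bits where
  "unit_weight = B0 (B0 (B0 (B0 (B0 (B0 (B0 (B0 (B0 (B0
    (B0 (B0 (B0 (B0 (B0 (B0 (B0 (B0 (B0 (B0 (B1 BZ))))))))))))))))))))"

text \<open>
  The value of a state is \<open>exp (- harmonic k)\<close> for the list \<open>[True]\<close>, and at most three times as much
  for \<open>[False]\<close>, because \<open>exp (1 / k) \<le> 3\<close>.
\<close>

fun tip_value :: "bool \<Rightarrow> trie \<Rightarrow> nat" where
  "tip_value up (Tip a b) = bits_val b + (if up then 3 * bits_val a else 0)"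
| "tip_value up t = 0"

definition weight :: "bool \<Rightarrow> nat \<Rightarrow> nat" where
  "weight up k = tip_value up (levels up k [1..<k] (path_trie (True # replicate (k - 1) False) unit_weight))"

text \<open>
  The factor \<open>1 + 1 / (k + 1) + 1 / (k + 1)^2\<close> bounds \<open>exp (harmonic (k + 1) - harmonic k)\<close>.
\<close>

definition certified :: "nat \<Rightarrow> bool" where
  "certified k \<longleftrightarrow> weight True k * ((k + 1)\<^sup>2 + (k + 1) + 1) < weight False (k + 1) * (k + 1)\<^sup>2"

lemma cycle_cap_ge: "cycle_cap k m \<ge> 2" by (auto simp: cycle_cap_def)

lemma divisors_pos:
  assumes "m > 0" "d \<in> set (divisors up k m)"
  shows "d > 0"
proof -
  have "m * cycle_cap k m \<ge> 1 * 2" using assms(1) cycle_cap_ge[of k m] by (intro mult_mono) auto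
  then show ?thesis using assms cycle_cap_ge[of k m] by (auto simp: divisors_def split: if_splits)
qed

lemma level_sum_divisors:
  assumes "0 < m" "m < k" "length x = Suc (k - m)"
  shows "rounds up (level_sum (state_value k (k - m)) (replicate m False) (divisors up k m) x)
    (state_value k (Suc (k - m)) x)"
proof -
  define M where "M = cycle_cap k m"
  have M: "M \<ge> 2" unfolding M_def by (rule cycle_cap_ge)
  have i: "k - m < k" "k - (k - m) = m" using assms by auto
  have v: "cycle_tail k (k - m) 0 (sums_of x) = state_value k (Suc (k - m)) x"
    by (simp only: cycle_tail_0 state_value_def)
  show ?thesis
  proof (cases up)
    case False
    have "divisors up k m = map (\<lambda>c. m * c) ([1..<M] @ [M])"
      unfolding divisors_def M_def[symmetric] using False by simp
    also have "[1..<M] @ [M] = [Suc 0..<Suc 0 + M]" using M by simp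
    finally have "divisors up k m = map (\<lambda>c. m * c) [Suc 0..<Suc 0 + M]" .
    then show ?thesis
      using level_sum_le[OF i(1) assms(3), of 0 M] False v i(2) by (simp add: rounds_def)
  next
    case True
    have e: "Suc 0 + (M - 1) = M" using M by simp
    have "m * M \<ge> 1 * 2" using assms(1) M by (intro mult_mono) auto
    then show ?thesis
      using level_sum_ge[OF i(1) assms(3), of 0 "M - 1"] True v
      unfolding i(2) e by (simp add: rounds_def divisors_def M_def[symmetric])
  qed
qed

text \<open>
  Treating all cycles of length \<open>m\<close> turns a measure on states of length \<open>k - m + 1\<close> into one on
  states of length \<open>k - m\<close>, and changes the integral of the state value only by rounding and by the
  truncation of the series.
\<close>

lemma level_divisors_rounds:
  assumes "0 < m" "m < k" "depth (Suc (k - m)) t"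
  shows "rounds up (trie_sum (level up (replicate m False) (divisors up k m) t) (state_value k (k - m)))
    (trie_sum t (state_value k (Suc (k - m))))"
proof (rule rounds_trans)
  show "rounds up (trie_sum (level up (replicate m False) (divisors up k m) t) (state_value k (k - m)))
    (trie_sum t (level_sum (state_value k (k - m)) (replicate m False) (divisors up k m)))"
    by (rule level_rounds[OF _ _ _ assms(3)])
      (use assms in \<open>auto simp: state_value_def avoid_lim_bounds divisors_pos\<close>)
  show "rounds up (trie_sum t (level_sum (state_value k (k - m)) (replicate m False) (divisors up k m)))
    (trie_sum t (state_value k (Suc (k - m))))"
    by (rule trie_sum_rounds[OF assms(3)]) (rule level_sum_divisors[OF assms(1,2)])
qed

lemma levels_rounds:
  assumes "0 < m" "m \<le> k" "depth (Suc (k - m)) t"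
  shows "depth 1 (levels up k [m..<k] t) \<and>
    rounds up (trie_sum (levels up k [m..<k] t) (state_value k 1)) (trie_sum t (state_value k (Suc (k - m))))"
  using assms
proof (induction "k - m" arbitrary: m t)
  case 0
  then show ?case by simp
next
  case (Suc i)
  define s where "s = level up (replicate m False) (divisors up k m) t"
  have mk: "m < k" "Suc (k - Suc m) = k - m" using Suc.hyps(2) by auto
  have "depth (Suc (k - m) - 1) s" unfolding s_def
    by (rule depth_level) (use Suc.prems mk in auto)
  then have "depth (Suc (k - Suc m)) s" using mk by simp
  then have IH: "depth 1 (levels up k [Suc m..<k] s) \<and>
    rounds up (trie_sum (levels up k [Suc m..<k] s) (state_value k 1)) (trie_sum s (state_value k (Suc (k - Suc m))))"
    by (intro Suc.hyps(1)) (use Suc.hyps(2) mk in auto)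
  have eq: "levels up k [m..<k] t = levels up k [Suc m..<k] s"
    using mk by (simp add: upt_conv_Cons s_def)
  have "rounds up (trie_sum s (state_value k (Suc (k - Suc m)))) (trie_sum t (state_value k (Suc (k - m))))"
    unfolding mk(2) s_def by (rule level_divisors_rounds) (use Suc.prems mk in auto)
  then show ?case unfolding eq using IH rounds_trans by blast
qed

lemma path_trie: "x \<noteq> [] \<Longrightarrow> depth (length x) (path_trie x w) \<and> trie_sum (path_trie x w) f = real (bits_val w) * f x"
  by (induction x w arbitrary: f rule: path_trie.induct) auto

text \<open>
  From \<open>0 \<in> A\<close>, any cycle of length \<open>k\<close> reaches \<open>k\<close>, so only the absence of such cycles contributes;
  from \<open>A = {}\<close> all numbers of them contribute, which gives the factor \<open>exp (1 / k)\<close>.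
\<close>

lemma tip_value_rounds:
  assumes "k > 0" "depth 1 t"
  shows "rounds up (tip_value up t * exp (- harmonic k)) (trie_sum t (state_value k 1))"
proof -
  have "cycle_tail k 0 1 (shift_union k {0}) = 0"
    by (rule cycle_tail_hit) (simp add: shift_union_def)
  then have "cycle_tail k 0 0 {0} = avoid_lim k 0 {0}"
    using cycle_tail_rec[of 0 k 0 "{0}"] assms(1) by simp
  then have "avoid_lim k 1 {0} = avoid_lim k 0 {0}" by (simp only: cycle_tail_0 One_nat_def)
  moreover have s: "sums_of [True] = {0}" "sums_of [False] = {}" by (auto simp: sums_of_def)
  ultimately have 1: "state_value k 1 [True] = exp (- harmonic k)"
    using assms(1) by (simp only: state_value_def avoid_lim.simps) simp
  have "avoid_lim k 1 {} = exp (1 / k) * exp (- harmonic k)"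
    using suminf_exp_series[of 1 k "exp (- harmonic k)"] by simp
  moreover have "exp (1 / k) \<le> exp (1 :: real)" using assms(1) by simp
  then have "exp (1 / k) \<le> 3" using exp_le by linarith
  ultimately have 0: "0 \<le> state_value k 1 [False]" "state_value k 1 [False] \<le> 3 * exp (- harmonic k)"
    by (simp_all only: state_value_def s mult_right_mono exp_ge_zero zero_le_mult_iff) simp
  show ?thesis
  proof (cases t)
    case (Tip a b)
    have "real (bits_val a) * state_value k 1 [False] \<le> real (bits_val a) * (3 * exp (- harmonic k))"
      by (intro mult_left_mono 0) auto
    then show ?thesis using Tip 0(1) 1 by (auto simp: rounds_def algebra_simps)
  qed (use assms(2) in auto)
qed

lemma weight_rounds:
  assumes "k > 0"
  shows "rounds up (weight up k * exp (- harmonic k)) (real (bits_val unit_weight) * avoid_lim k k {0})"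
proof -
  define x where "x = True # replicate (k - 1) False"
  define t where "t = path_trie x unit_weight"
  have x: "x \<noteq> []" "length x = Suc (k - 1)" by (simp_all add: x_def)
  have t: "depth (Suc (k - 1)) t" "trie_sum t (state_value k k) = real (bits_val unit_weight) * state_value k k x"
    using path_trie[OF x(1)] x(2) by (auto simp: t_def)
  have "s \<in> sums_of x \<longleftrightarrow> s = 0" for s
    by (cases s) (auto simp: sums_of_def x_def)
  then have "sums_of x = {0}" by blast
  then have v: "state_value k k x = avoid_lim k k {0}" by (simp add: state_value_def)
  have L: "depth 1 (levels up k [1..<k] t)"
    "rounds up (trie_sum (levels up k [1..<k] t) (state_value k 1)) (trie_sum t (state_value k (Suc (k - 1))))"
    using levels_rounds[of 1 k t up] assms t(1) by auto
  have "rounds up (weight up k * exp (- harmonic k)) (trie_sum (levels up k [1..<k] t) (state_value k 1))"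
    using tip_value_rounds[OF assms L(1)] by (simp add: weight_def t_def x_def)
  then show ?thesis using rounds_trans[OF _ L(2)] assms t(2) v by simp
qed

lemma certified_imp:
  assumes "k > 0" "certified k"
  shows "i_infty k > i_infty (k + 1)"
proof -
  define w where "w = real (bits_val unit_weight)"
  define x where "x = 1 / real (k + 1)"
  have w: "w > 0" by (simp add: w_def unit_weight_def)
  have U: "w * avoid_lim k k {0} \<le> weight True k * exp (- harmonic k)"
    using weight_rounds[OF assms(1), of True] by (simp add: rounds_def w_def)
  have L: "weight False (k + 1) * exp (- harmonic (k + 1)) \<le> w * avoid_lim (k + 1) (k + 1) {0}"
    using weight_rounds[of "k + 1" False] by (simp add: rounds_def w_def)
  have "exp x \<le> 1 + x + x\<^sup>2" by (rule exp_bound) (auto simp: x_def)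
  then have "weight True k * exp x \<le> weight True k * (1 + x + x\<^sup>2)" by (intro mult_left_mono) auto
  also have "\<dots> < weight False (k + 1)"
  proof -
    have "real (weight True k * ((k + 1)\<^sup>2 + (k + 1) + 1)) < real (weight False (k + 1) * (k + 1)\<^sup>2)"
      using assms(2) unfolding certified_def by (simp only: of_nat_less_iff)
    then have "real (weight True k) * ((real (k + 1))\<^sup>2 + real (k + 1) + 1) < real (weight False (k + 1)) * (real (k + 1))\<^sup>2"
      by (simp only: of_nat_mult of_nat_add of_nat_power of_nat_1)
    moreover have "a * (1 + 1 / y + (1 / y)\<^sup>2) < b" if "a * (y\<^sup>2 + y + 1) < b * y\<^sup>2" "y > 0" for a b y :: real
    proof -
      have "a * (1 + 1 / y + (1 / y)\<^sup>2) = a * (y\<^sup>2 + y + 1) / y\<^sup>2"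
        using that(2) by (simp add: field_simps power2_eq_square)
      also have "\<dots> < b" using that by (simp add: pos_divide_less_eq)
      finally show ?thesis .
    qed
    ultimately show ?thesis unfolding x_def by simp
  qed
  finally have "weight True k * exp x * exp (- harmonic (k + 1)) < weight False (k + 1) * exp (- harmonic (k + 1))"
    by simp
  moreover have "exp x * exp (- harmonic (k + 1)) = exp (- harmonic k)"
    by (simp add: exp_add[symmetric] harmonic_def x_def)
  ultimately have "weight True k * exp (- harmonic k) < weight False (k + 1) * exp (- harmonic (k + 1))"
    by (simp only: mult.assoc)
  then have "w * avoid_lim k k {0} < w * avoid_lim (k + 1) (k + 1) {0}" using U L by linarith
  then show ?thesis using w by (simp add: i_infty_eq)
qed

section \<open>Evaluation\<close>

lemma upt_0_numeral: "[0..<numeral n] = 0 # [Suc 0..<numeral n]"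
  by (simp add: upt_rec[of 0])

lemma upt_Suc_0_numeral: "[Suc 0..<numeral n] = (if numeral n = (1::nat) then [] else Suc 0 # [2..<numeral n])"
  by (auto simp: upt_rec[of "Suc 0"] numeral_2_eq_2)

lemma replicate_numeral_eq: "replicate (numeral n) x = x # replicate (pred_numeral n) x"
  by (simp add: numeral_eq_Suc)

text \<open>
  For a concrete divisor the long division is a finite automaton whose states are the remainders.
  Its transition tables are prepared in advance, so that no arithmetic is needed during evaluation.
\<close>

lemma div_table:
  "list_all (\<lambda>r.
     div_step False d (Quot q r) =
       (if 2 * r < d then Quot (bits_double q) (2 * r) else Quot (B1 q) (2 * r - d)) \<and>
     div_step True d (Quot q r) =
       (if 2 * r + 1 < d then Quot (bits_double q) (2 * r + 1) else Quot (B1 q) (2 * r + 1 - d)))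
     [0..<d]"
  by (simp add: list_all_iff)

declare upt_0_numeral [simp] upt_Suc_0_numeral [simp] replicate_numeral_eq [simp]
  div_step.simps [simp del] bits_double.simps [simp del]

lemmas division_tables =
  div_table[of 1, simplified] div_table[of 2, simplified] div_table[of 3, simplified]
  div_table[of 4, simplified] div_table[of 5, simplified] div_table[of 6, simplified]
  div_table[of 7, simplified] div_table[of 8, simplified] div_table[of 9, simplified]
  div_table[of 10, simplified] div_table[of 11, simplified] div_table[of 12, simplified]
  div_table[of 13, simplified] div_table[of 14, simplified] div_table[of 15, simplified]
  div_table[of 16, simplified] div_table[of 17, simplified] div_table[of 18, simplified]
  div_table[of 19, simplified] div_table[of 20, simplified] div_table[of 21, simplified]
  div_table[of 22, simplified] div_table[of 23, simplified] div_table[of 24, simplified]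
  div_table[of 25, simplified] div_table[of 26, simplified] div_table[of 27, simplified]
  div_table[of 28, simplified] div_table[of 29, simplified] div_table[of 30, simplified]
  div_table[of 31, simplified] div_table[of 32, simplified] div_table[of 33, simplified]
  div_table[of 34, simplified] div_table[of 35, simplified] div_table[of 36, simplified]
  div_table[of 37, simplified] div_table[of 38, simplified] div_table[of 39, simplified]
  div_table[of 40, simplified] div_table[of 41, simplified] div_table[of 42, simplified]
  div_table[of 43, simplified] div_table[of 44, simplified] div_table[of 45, simplified]
  div_table[of 46, simplified] div_table[of 47, simplified] div_table[of 48, simplified]
  div_table[of 49, simplified] div_table[of 50, simplified] div_table[of 51, simplified]
  div_table[of 52, simplified] div_table[of 53, simplified] div_table[of 54, simplified]
  div_table[of 55, simplified] div_table[of 56, simplified] div_table[of 58, simplified]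

declare bits_inc.simps [simp del] bits_add.simps [simp del] bits_div.simps [simp del]
  rounded.simps [simp del] mk_node.simps [simp del] mk_tip.simps [simp del]
  merge.simps [simp del] shift_trie.simps [simp del] drop_last.simps [simp del]
  level.simps [simp del] tip_value.simps [simp del] bits_val.simps [simp del]

lemmas schedule_rules = certified_def weight_def unit_weight_def levels.simps divisors_def
  cycle_cap_def path_trie.simps

lemmas trie_rules = bits_inc.simps bits_add.simps bits_double.simps bits_div.simps rounded.simps
  mk_node.simps mk_tip.simps merge.simps shift_trie.simps drop_last.simps level.simps
  append.simps division_tables

text \<open>
  Each evaluation has three stages: the list of lengths and divisors is expanded, the tries are
  computed by the rewrite rules of the trie operations only, and the two resulting numbers are
  compared.
\<close>

lemma certified_1_to_20:
  shows "certified 1" "certified 2" "certified 3" "certified 4" "certified 5" "certified 6"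
    "certified 7" "certified 8" "certified 9" "certified 10" "certified 11" "certified 12"
    "certified 13" "certified 14" "certified 15" "certified 16" "certified 17" "certified 18"
    "certified 19" "certified 20"
  by (simp_all add: schedule_rules, simp_all only: trie_rules,
      simp_all add: tip_value.simps bits_val.simps power2_eq_square)

lemma certified_21_to_24:
  shows "certified 21" "certified 22" "certified 23" "certified 24"
  by (simp_all add: schedule_rules, simp_all only: trie_rules,
      simp_all add: tip_value.simps bits_val.simps power2_eq_square)

lemma certified_25_26:
  shows "certified 25" "certified 26"
  by (simp_all add: schedule_rules, simp_all only: trie_rules,
      simp_all add: tip_value.simps bits_val.simps power2_eq_square)

lemma certified_27:
  shows "certified 27"
  by (simp_all add: schedule_rules, simp_all only: trie_rules,
      simp_all add: tip_value.simps bits_val.simps power2_eq_square)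

lemma certified_28:
  shows "certified 28"
  by (simp_all add: schedule_rules, simp_all only: trie_rules,
      simp_all add: tip_value.simps bits_val.simps power2_eq_square)

lemma certified_29:
  shows "certified 29"
  by (simp_all add: schedule_rules, simp_all only: trie_rules,
      simp_all add: tip_value.simps bits_val.simps power2_eq_square)

theorem mainTheorem1:
  fixes k :: nat
  assumes "1 \<le> k" and "k \<le> 29"
  shows "i_infty k > i_infty (k + 1)"
proof (rule certified_imp)
  have "list_all certified [1..<30]"
    by (simp add: certified_1_to_20[unfolded One_nat_def]
      certified_21_to_24 certified_25_26 certified_27 certified_28 certified_29)
  then have "\<forall>j\<in>set [1..<30]. certified j" by (simp only: list_all_iff)
  moreover have "k \<in> set [1..<30]" unfolding set_upt using assms by simp
  ultimately show "certified k" ..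
qed (use assms in simp)

end
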